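(* Let $k,p\in\mathbb N$ with $1\le k\le p$, and assume $k,p\to+\infty$ with $k=o(p)$. Fix parameters $\nu>0$, $R\in(0,1)$, $\delta,\epsilon\in[0,1)$ such that $\delta\epsilon>0$, set $k'=\lfloor(1+\epsilon)k\rfloor$, and assume that we observe the outcome of $n=\lfloor\log_2\binom{p}{k}/R\rfloor$ tests under non-adaptive Bernoulli group testing in which each item participates in a test with probability $\nu/k$. If $$R<\frac{\nu e^{-\nu}}{\ln2}+\sup_{\lambda\ge0}\ \inf_{\zeta\in[0,1-\delta)}Q(\lambda,\zeta,\nu,\epsilon),$$ where $$Q(\lambda,\zeta,\nu,\epsilon)=-\frac{\ln\!\left(e^{-\nu(1+\epsilon)}\Big(e^{\nu(1-\zeta)\big(e^{-\frac{\lambda(1+\epsilon-\zeta)}{1-\zeta}}-1\big)}-1\Big)+(1+\epsilon-\zeta)\,\nu\, e^{-\nu(1+\epsilon)}\big(1-e^{-\nu(1-\zeta)}\big)(e^{\lambda}-1)+1\right)}{(1+\epsilon-\zeta)\ln2},$$ then, asymptotically almost surely as $p\to+\infty$, there exists no $(\delta,\epsilon)$-bad local minimum in $\Omega_{k'}$.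
   Context: Non-adaptive Bernoulli group testing: there are $p$ items, $k$ of which are defective (a uniformly random $k$-subset); in each of $n$ tests every item is included with probability $\nu/k$, independently over items and tests. A test is positive if it contains at least one defective item, negative otherwise. An item is potentially defective if it participates in no negative test; $\mathrm{PD}$ is the set of potentially defective items. For an integer $k'$, $\Omega_{k'}$ is the set of all subsets of $\mathrm{PD}$ of size exactly $k'$ ("states"). For $\sigma\in\Omega_{k'}$, $P(\sigma)$ is the number of positive tests explained by $\sigma$, i.e. containing at least one item of $\sigma$, and $\mathcal T_\sigma=\{(\sigma\cup\{j\})\setminus\{i\}: i\in\sigma,\ j\in\mathrm{PD}\setminus\sigma\}$. With $k'=\lfloor(1+\epsilon)k\rfloor$, a state $\sigma\in\Omega_{k'}$ is a $(\delta,\epsilon)$-bad local minimum if it contains fewer than $\lfloor(1-\delta)k\rfloor$ defective items and there is no $\tau\in\mathcal T_\sigma$ with $P(\tau)\ge P(\sigma)+1$. Asymptotically almost surely means with probability tending to $1$ as $p\to+\infty$. *)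

theory Defs
  imports "HOL-Probability.Probability" "HOL-Library.Landau_Symbols"
begin

text \<open>
  Items are \<open>{..<p}\<close>, tests are \<open>{..<n}\<close>. An outcome of the experiment is a pair \<open>(D, X)\<close>:
  \<open>D\<close> is the set of defective items and \<open>X (t, i)\<close> says that item \<open>i\<close> participates in test \<open>t\<close>.
\<close>

type_synonym design = "nat \<times> nat \<Rightarrow> bool"

text \<open>
  For \<open>k \<le> p\<close> the set of \<open>k\<close>-subsets is nonempty, so \<open>pmf_of_set\<close> is the uniform distribution.
  The library's \<open>bernoulli_pmf\<close> truncates its parameter to \<open>[0, 1]\<close>; this only matters while
  \<open>k < \<nu>\<close>, where \<open>\<nu> / k\<close> is not a probability.
\<close>

definition group_testing_pmf :: "nat \<Rightarrow> nat \<Rightarrow> nat \<Rightarrow> real \<Rightarrow> (nat set \<times> design) pmf" where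
  "group_testing_pmf p k n \<nu> =
     pair_pmf
       (pmf_of_set {D. D \<subseteq> {..<p} \<and> card D = k})
       (Pi_pmf ({..<n} \<times> {..<p}) False (\<lambda>_. bernoulli_pmf (\<nu> / real k)))"

definition contains_item_of :: "design \<Rightarrow> nat \<Rightarrow> nat set \<Rightarrow> bool" where
  "contains_item_of X t A \<longleftrightarrow> (\<exists>i\<in>A. X (t, i))"

definition positive_test :: "nat set \<Rightarrow> design \<Rightarrow> nat \<Rightarrow> bool" where
  "positive_test D X t \<longleftrightarrow> contains_item_of X t D"

definition PD :: "nat \<Rightarrow> nat \<Rightarrow> nat set \<Rightarrow> design \<Rightarrow> nat set" where
  "PD p n D X = {i\<in>{..<p}. \<not> (\<exists>t<n. \<not> positive_test D X t \<and> X (t, i))}"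

definition states :: "nat \<Rightarrow> nat \<Rightarrow> nat set \<Rightarrow> design \<Rightarrow> nat \<Rightarrow> nat set set" where
  "states p n D X k' = {\<sigma>. \<sigma> \<subseteq> PD p n D X \<and> card \<sigma> = k'}"

definition explained :: "nat \<Rightarrow> nat set \<Rightarrow> design \<Rightarrow> nat set \<Rightarrow> nat" where
  "explained n D X \<sigma> = card {t\<in>{..<n}. positive_test D X t \<and> contains_item_of X t \<sigma>}"

definition swaps :: "nat \<Rightarrow> nat \<Rightarrow> nat set \<Rightarrow> design \<Rightarrow> nat set \<Rightarrow> nat set set" where
  "swaps p n D X \<sigma> = {(\<sigma> \<union> {j}) - {i} | i j. i \<in> \<sigma> \<and> j \<in> PD p n D X - \<sigma>}"

definition bad_local_minimum ::
  "nat \<Rightarrow> nat \<Rightarrow> nat \<Rightarrow> real \<Rightarrow> real \<Rightarrow> nat set \<Rightarrow> design \<Rightarrow> nat set \<Rightarrow> bool" where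
  "bad_local_minimum p k n \<delta> \<epsilon> D X \<sigma> \<longleftrightarrow>
     \<sigma> \<in> states p n D X (nat \<lfloor>(1 + \<epsilon>) * real k\<rfloor>) \<and>
     int (card (\<sigma> \<inter> D)) < \<lfloor>(1 - \<delta>) * real k\<rfloor> \<and>
     \<not> (\<exists>\<tau>\<in>swaps p n D X \<sigma>. explained n D X \<tau> \<ge> explained n D X \<sigma> + 1)"

definition num_tests :: "nat \<Rightarrow> nat \<Rightarrow> real \<Rightarrow> nat" where
  "num_tests p k R = nat \<lfloor>log 2 (real (p choose k)) / R\<rfloor>"

definition Q :: "real \<Rightarrow> real \<Rightarrow> real \<Rightarrow> real \<Rightarrow> real" where
  "Q l \<zeta> \<nu> \<epsilon> =
     - (ln (exp (- \<nu> * (1 + \<epsilon>)) *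
              (exp (\<nu> * (1 - \<zeta>) * (exp (- (l * (1 + \<epsilon> - \<zeta>) / (1 - \<zeta>))) - 1)) - 1)
            + (1 + \<epsilon> - \<zeta>) * \<nu> * exp (- \<nu> * (1 + \<epsilon>)) *
              (1 - exp (- \<nu> * (1 - \<zeta>))) * (exp l - 1)
            + 1)
        / ((1 + \<epsilon> - \<zeta>) * ln 2))"

text \<open>
  The real-valued infima and suprema below are genuine (never the junk value of an unbounded set):
  for \<open>\<nu> > 0\<close>, \<open>\<delta>, \<epsilon> \<in> (0, 1)\<close>, \<open>l \<ge> 0\<close> and \<open>\<zeta> \<in> [0, 1 - \<delta>)\<close>, the argument of \<open>ln\<close> in \<open>Q\<close>
  lies between \<open>1 - exp (- \<nu> (1 + \<epsilon>)) > 0\<close> and \<open>1 + (1 + \<epsilon>) \<nu> (exp l - 1)\<close>, and \<open>1 + \<epsilon> - \<zeta> > \<delta> + \<epsilon>\<close>.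
  Hence each infimum is over a set bounded below, and the infima are bounded above uniformly in \<open>l\<close>.
\<close>

definition rate_threshold :: "real \<Rightarrow> real \<Rightarrow> real \<Rightarrow> real" where
  "rate_threshold \<nu> \<delta> \<epsilon> =
     \<nu> * exp (- \<nu>) / ln 2 + (SUP l\<in>{0..}. INF \<zeta>\<in>{0..<1 - \<delta>}. Q l \<zeta> \<nu> \<epsilon>)"

end

theory Submission
  imports Defs "HOL-Real_Asymp.Real_Asymp"
begin

text \<open>
  Let \<open>s\<close> be a bad local minimum, \<open>m = card (s - D)\<close>, \<open>u = card (D - s)\<close>, \<open>q = \<nu> / k\<close>. Swapping
  \<open>i \<in> s - D\<close> for \<open>j \<in> D - s\<close> gains the tests that contain \<open>j\<close> and miss \<open>s\<close> (\<open>G j\<close> many) and loses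
  at most the tests in which \<open>i\<close> is the only item of \<open>s\<close> (\<open>L i\<close> many), so \<open>G j \<le> L i\<close> for all such
  pairs, and averaging gives \<open>m / u * (\<Sum>j. G j) \<le> (\<Sum>i. L i)\<close>. The tests are independent, and
  the exponential Markov inequality with parameter \<open>l\<close> bounds the probability of this event by the
  \<open>n\<close>-th power of a moment generating function, the argument of the logarithm in \<open>Q\<close> up to \<open>o(1)\<close>.
  On the event that there are at least \<open>c\<close> negative tests, the requirement \<open>s \<subseteq> PD\<close> contributes a
  further factor \<open>(1 - q) ^ (m * c)\<close>; a Chernoff bound allows \<open>c\<close> close to \<open>n * exp (- \<nu>)\<close>. There are at
  most \<open>2 ^ k * (p choose m)\<close> sets \<open>s\<close> with a given overlap. On the scale \<open>k * ln (p / k)\<close> the logarithm of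
  the resulting union bound is at most
  \<open>(1 + \<epsilon> - \<zeta>) / R * (R - \<nu> * exp (- \<nu>) / ln 2 - Q l \<zeta> \<nu> \<epsilon>) + o(1)\<close>, uniformly in the overlap
  fraction \<open>\<zeta> < 1 - \<delta>\<close>.
\<close>

section \<open>Product measures on designs\<close>

text \<open>Currying a design turns it into a family of independent rows, one per test, which is
  what lets per-test expectations multiply. The mass functions are compared pointwise: on functions
  equal to \<open>d\<close> off \<open>A \<times> B\<close> they are the same double product, on all
  others both vanish.\<close>

lemma Pi_pmf_Times:
  assumes "finite A" "finite B"
  shows "Pi_pmf (A \<times> B) d (\<lambda>_. P) =
    map_pmf (\<lambda>F (x, y). F x y) (Pi_pmf A (\<lambda>_. d) (\<lambda>_. Pi_pmf B d (\<lambda>_. P)))"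
proof (rule pmf_eqI)
  fix f :: "'a \<times> 'b \<Rightarrow> 'c"
  have inj: "inj (\<lambda>F (x, y). F x y :: 'c)"
    by (auto simp: inj_def fun_eq_iff)
  have f: "f = (\<lambda>(x, y). curry f x y)" by auto
  have "pmf (map_pmf (\<lambda>F (x, y). F x y) (Pi_pmf A (\<lambda>_. d) (\<lambda>_. Pi_pmf B d (\<lambda>_. P)))) f =
      pmf (Pi_pmf A (\<lambda>_. d) (\<lambda>_. Pi_pmf B d (\<lambda>_. P))) (curry f)"
    by (subst f, rule pmf_map_inj'[OF inj])
  also have "\<dots> = pmf (Pi_pmf (A \<times> B) d (\<lambda>_. P)) f"
  proof (cases "\<forall>z. z \<notin> A \<times> B \<longrightarrow> f z = d")
    case True
    then show ?thesis
      using assms by (auto simp: pmf_Pi fun_eq_iff prod.cartesian_product)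
  next
    case False
    then obtain x y where xy: "(x, y) \<notin> A \<times> B" "f (x, y) \<noteq> d" by auto
    have "pmf (Pi_pmf (A \<times> B) d (\<lambda>_. P)) f = 0"
      using assms xy by (intro pmf_Pi_outside) auto
    moreover have "pmf (Pi_pmf A (\<lambda>_. d) (\<lambda>_. Pi_pmf B d (\<lambda>_. P))) (curry f) = 0"
    proof (cases "x \<in> A")
      case True
      then have "pmf (Pi_pmf B d (\<lambda>_. P)) (curry f x) = 0"
        using assms xy by (intro pmf_Pi_outside) auto
      then show ?thesis
        using True assms(1) by (auto simp: pmf_Pi)
    next
      case False
      then show ?thesis
        using assms xy by (intro pmf_Pi_outside) (auto simp: fun_eq_iff)
    qed
    ultimately show ?thesis by simp
  qed
  finally show "pmf (Pi_pmf (A \<times> B) d (\<lambda>_. P)) f =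
      pmf (map_pmf (\<lambda>F (x, y). F x y) (Pi_pmf A (\<lambda>_. d) (\<lambda>_. Pi_pmf B d (\<lambda>_. P)))) f" ..
qed

lemma finite_set_Pi_pmf:
  assumes "finite A" "\<And>x. x \<in> A \<Longrightarrow> finite (set_pmf (P x))"
  shows "finite (set_pmf (Pi_pmf A d P))"
  using assms by (simp add: set_Pi_pmf finite_PiE_dflt)

lemma expectation_prod_rows:
  fixes h :: "('b \<Rightarrow> 'c) \<Rightarrow> real"
  assumes "finite A" "finite B" "finite (set_pmf P)" "\<And>y. h y \<ge> 0"
  shows "measure_pmf.expectation (Pi_pmf (A \<times> B) d (\<lambda>_. P)) (\<lambda>X. \<Prod>t\<in>A. h (\<lambda>i. X (t, i))) =
    measure_pmf.expectation (Pi_pmf B d (\<lambda>_. P)) h ^ card A"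
proof -
  have fin: "finite (set_pmf (Pi_pmf B d (\<lambda>_. P)))"
    using assms by (intro finite_set_Pi_pmf)
  have "measure_pmf.expectation (Pi_pmf (A \<times> B) d (\<lambda>_. P)) (\<lambda>X. \<Prod>t\<in>A. h (\<lambda>i. X (t, i))) =
    measure_pmf.expectation (Pi_pmf A (\<lambda>_. d) (\<lambda>_. Pi_pmf B d (\<lambda>_. P))) (\<lambda>F. \<Prod>t\<in>A. h (F t))"
    using assms by (simp add: Pi_pmf_Times)
  also have "\<dots> = (\<Prod>t\<in>A. measure_pmf.expectation (Pi_pmf B d (\<lambda>_. P)) h)"
    using assms by (intro expectation_prod_Pi_pmf integrable_measure_pmf_finite fin)
  finally show ?thesis by simp
qed

text \<open>Markov's inequality for a product of row weights, with the mean factorised over the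
  tests. It serves both tail bounds below: local optimality, with \<open>row_weight\<close>, and the
  Chernoff bound for the number of negative tests.\<close>

lemma prob_rows_le:
  fixes h :: "('b \<Rightarrow> 'c) \<Rightarrow> real"
  assumes "finite A" "finite B" "finite (set_pmf P)" "\<And>y. h y \<ge> 0" "c > 0"
    and "\<And>X. X \<in> E \<Longrightarrow> c \<le> (\<Prod>t\<in>A. h (\<lambda>i. X (t, i)))"
  shows "measure_pmf.prob (Pi_pmf (A \<times> B) d (\<lambda>_. P)) E \<le>
    measure_pmf.expectation (Pi_pmf B d (\<lambda>_. P)) h ^ card A / c"
proof -
  let ?M = "Pi_pmf (A \<times> B) d (\<lambda>_. P)"
  let ?f = "\<lambda>X. \<Prod>t\<in>A. h (\<lambda>i. X (t, i))"
  have fin: "finite (set_pmf ?M)"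
    using assms by (intro finite_set_Pi_pmf) auto
  have "measure_pmf.prob ?M E \<le> measure_pmf.prob ?M {X \<in> space (measure_pmf ?M). ?f X \<ge> c}"
    using assms by (intro measure_pmf.finite_measure_mono) auto
  also have "\<dots> \<le> measure_pmf.expectation ?M ?f / c"
    using assms fin
    by (intro integral_Markov_inequality_measure[where A = "{}"] integrable_measure_pmf_finite)
       (auto intro: prod_nonneg)
  finally show ?thesis
    using assms by (simp add: expectation_prod_rows)
qed

lemma expectation_prod_bernoulli:
  fixes g :: "'a \<Rightarrow> bool \<Rightarrow> real"
  assumes "finite B" "C \<subseteq> B" "q \<in> {0..1}" "\<And>i b. g i b \<ge> 0"
  shows "measure_pmf.expectation (Pi_pmf B d (\<lambda>_. bernoulli_pmf q)) (\<lambda>y. \<Prod>i\<in>C. g i (y i)) =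
    (\<Prod>i\<in>C. q * g i True + (1 - q) * g i False)"
proof -
  let ?g = "\<lambda>i b. if i \<in> C then g i b else 1"
  have "measure_pmf.expectation (Pi_pmf B d (\<lambda>_. bernoulli_pmf q)) (\<lambda>y. \<Prod>i\<in>C. g i (y i)) =
      measure_pmf.expectation (Pi_pmf B d (\<lambda>_. bernoulli_pmf q)) (\<lambda>y. \<Prod>i\<in>B. ?g i (y i))"
    using assms by (simp add: prod.If_cases Int_absorb1)
  also have "\<dots> = (\<Prod>i\<in>B. measure_pmf.expectation (bernoulli_pmf q) (?g i))"
    using assms by (intro expectation_prod_Pi_pmf integrable_measure_pmf_finite) auto
  also have "\<dots> = (\<Prod>i\<in>B. if i \<in> C then q * g i True + (1 - q) * g i False else 1)"
    using assms by (intro prod.cong) (auto simp: algebra_simps)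
  also have "\<dots> = (\<Prod>i\<in>C. q * g i True + (1 - q) * g i False)"
    using assms by (simp add: prod.If_cases Int_absorb1)
  finally show ?thesis .
qed

section \<open>The moment generating function of a test\<close>

text \<open>
  Summed over all tests, \<open>row_score D s c\<close> is \<open>(\<Sum>i\<in>s - D. L i) - c * (\<Sum>j\<in>D - s. G j)\<close>, where \<open>L i\<close>
  counts the tests that meet \<open>s\<close> only in \<open>i\<close> and \<open>G j\<close> the tests that contain \<open>j\<close> and miss \<open>s\<close>.
\<close>

definition row_score :: "nat set \<Rightarrow> nat set \<Rightarrow> real \<Rightarrow> (nat \<Rightarrow> bool) \<Rightarrow> real" where
  "row_score D s c y =
     (\<Sum>i\<in>s - D. of_bool (\<forall>i'\<in>s. y i' = (i' = i))) -
     c * (\<Sum>j\<in>D - s. of_bool (y j \<and> (\<forall>i\<in>s. \<not> y i)))"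

text \<open>
  On a negative test the weight vanishes unless \<open>s - D\<close> avoids the test, which is what \<open>s \<subseteq> PD\<close>
  demands. The factor \<open>1 / (1 - q) ^ card (s - D)\<close> makes the expected weight of a negative test
  \<open>1\<close>, so that no price is paid for a fluctuation in the number of negative tests, whose
  lower tail is controlled separately.
\<close>

definition row_weight ::
  "real \<Rightarrow> real \<Rightarrow> nat set \<Rightarrow> nat set \<Rightarrow> (nat \<Rightarrow> bool) \<Rightarrow> real" where
  "row_weight q l D s y =
     (if \<exists>i\<in>D. y i then exp (l * row_score D s (card (s - D) / card (D - s)) y)
      else if \<exists>i\<in>s - D. y i then 0 else 1 / (1 - q) ^ card (s - D))"

text \<open>The mean of \<open>row_weight\<close>, with \<open>a\<close>, \<open>m\<close>,
  \<open>u\<close> standing for the sizes of \<open>s\<close>, \<open>s - D\<close>,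
  \<open>D - s\<close>. The second summand corrects for tests that miss \<open>s\<close>, the third
  for positive tests that meet \<open>s\<close> in a single non-defective item. The truncation in
  \<open>a - 1\<close> is harmless, since \<open>a = 0\<close> then forces
  \<open>m = 0\<close>.\<close>

definition row_mgf :: "real \<Rightarrow> real \<Rightarrow> nat \<Rightarrow> nat \<Rightarrow> nat \<Rightarrow> real" where
  "row_mgf q l a m u =
     1 + (1 - q) ^ a * ((1 - q + q * exp (- (l * (m / u)))) ^ u - 1) +
     m * q * (1 - q) ^ (a - 1) * (1 - (1 - q) ^ u) * (exp l - 1)"

lemma row_weight_nonneg: "q \<le> 1 \<Longrightarrow> row_weight q l D s y \<ge> 0"
  by (simp add: row_weight_def)

lemma of_bool_Ball:
  "finite C \<Longrightarrow> of_bool (\<forall>i\<in>C. P i) = (\<Prod>i\<in>C. of_bool (P i) :: real)"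
  by (induction rule: finite_induct) auto

lemma expectation_pattern_bernoulli:
  assumes "finite B" "C \<subseteq> B" "q \<in> {0..1}"
  shows "measure_pmf.expectation (Pi_pmf B d (\<lambda>_. bernoulli_pmf q))
      (\<lambda>y. of_bool (\<forall>i\<in>C. y i = v i)) = (\<Prod>i\<in>C. if v i then q else 1 - q)"
proof -
  have fC: "finite C" using assms finite_subset by blast
  have "measure_pmf.expectation (Pi_pmf B d (\<lambda>_. bernoulli_pmf q))
      (\<lambda>y. of_bool (\<forall>i\<in>C. y i = v i)) = (\<Prod>i\<in>C. q * of_bool (True = v i) + (1 - q) * of_bool (False = v i))"
    unfolding of_bool_Ball[OF fC]
    by (rule expectation_prod_bernoulli) (use assms in auto)
  also have "\<dots> = (\<Prod>i\<in>C. if v i then q else 1 - q)"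
    by (intro prod.cong) auto
  finally show ?thesis .
qed

text \<open>Writes the weight as a linear combination of products of single-item functions, whose
  means factorise. The value 1 is the default on positive tests; \<open>?W - ?S\<close> corrects it
  on tests that miss \<open>s\<close> and cancels on negative ones; \<open>?T\<close> flags the
  positive tests that meet \<open>s\<close> in exactly one item, a non-defective one.\<close>

lemma row_weight_expand:
  fixes q l :: real
  assumes "finite D" "finite s"
  defines "w \<equiv> exp (- (l * (card (s - D) / card (D - s))))"
  shows "row_weight q l D s y =
    of_bool (\<forall>i\<in>s \<union> D. y i = False) / (1 - q) ^ card (s - D) + 1 - of_bool (\<forall>i\<in>D. y i = False) +
    (\<Prod>i\<in>s \<union> D. if i \<in> s then of_bool (\<not> y i) else if y i then w else 1) - of_bool (\<forall>i\<in>s. y i = False) +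
    (exp l - 1) * (\<Sum>i\<in>s - D. of_bool (\<forall>i'\<in>s. y i' = (i' = i)) - of_bool (\<forall>i'\<in>s \<union> D. y i' = (i' = i)))"
    (is "_ = ?A + 1 - ?B + ?W - ?S + _ * ?T")
proof -
  have split: "?W = (\<Prod>i\<in>s. of_bool (\<not> y i)) * (\<Prod>i\<in>D - s. if y i then w else 1)"
  proof -
    have "?W = (\<Prod>i\<in>s \<union> (D - s). if i \<in> s then of_bool (\<not> y i) else if y i then w else 1)"
      by (rule prod.cong) auto
    also have "\<dots> = (\<Prod>i\<in>s. of_bool (\<not> y i)) * (\<Prod>i\<in>D - s. if y i then w else 1)"
      using assms by (subst prod.union_disjoint) (auto intro!: arg_cong2[where f = "(*)"] prod.cong)
    finally show ?thesis .
  qed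
  then have W: "?W = of_bool (\<forall>i\<in>s. \<not> y i) * (\<Prod>i\<in>D - s. if y i then w else 1)"
    by (simp only: of_bool_Ball[OF assms(2)])
  consider (neg) "\<forall>i\<in>D. \<not> y i" | (miss) "\<exists>i\<in>D. y i" "\<forall>i\<in>s. \<not> y i"
    | (single) i0 where "\<exists>i\<in>D. y i" "i0 \<in> s - D" "\<forall>i'\<in>s. y i' = (i' = i0)"
    | (other) "\<exists>i\<in>D. y i" "\<exists>i\<in>s. y i" "\<forall>i\<in>s - D. \<not> (\<forall>i'\<in>s. y i' = (i' = i))"
    by blast
  then show ?thesis
  proof cases
    case neg
    have T: "?T = 0"
      using neg by (intro sum.neutral) auto
    have P: "(\<Prod>i\<in>D - s. if y i then w else 1) = 1"
      using neg by (intro prod.neutral) auto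
    show ?thesis
      using neg by (auto simp: row_weight_def W P T)
  next
    case miss
    have T: "?T = 0"
      using miss by (intro sum.neutral) auto
    have "(\<Sum>i\<in>s - D. of_bool (\<forall>i'\<in>s. y i' = (i' = i))) = (0 :: real)"
      using miss by (intro sum.neutral) auto
    then have "row_score D s (card (s - D) / card (D - s)) y =
        - (card (s - D) / card (D - s) * (\<Sum>j\<in>D - s. of_bool (y j)))"
      using miss by (simp add: row_score_def)
    then have "exp (l * row_score D s (card (s - D) / card (D - s)) y) =
        exp (\<Sum>j\<in>D - s. - (l * (card (s - D) / card (D - s))) * of_bool (y j))"
      by (simp only: sum_distrib_left[symmetric]) (simp add: algebra_simps)
    also have "\<dots> = (\<Prod>j\<in>D - s. if y j then w else 1)"
      using assms by (subst exp_sum) (auto simp: w_def intro!: prod.cong)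
    finally show ?thesis
      unfolding T W using miss by (auto simp: row_weight_def)
  next
    case single
    have score: "row_score D s c y = 1" for c
    proof -
      have "(\<Sum>j\<in>D - s. of_bool (y j \<and> (\<forall>i\<in>s. \<not> y i))) = (0 :: real)"
        using single by (intro sum.neutral) auto
      moreover have "(\<Sum>i\<in>s - D. of_bool (\<forall>i'\<in>s. y i' = (i' = i))) = (\<Sum>i\<in>s - D. of_bool (i = i0) :: real)"
        using single by (intro sum.cong arg_cong[where f = of_bool]) auto
      ultimately show ?thesis
        using single assms by (simp add: row_score_def of_bool_def sum.delta)
    qed
    have "?T = (\<Sum>i\<in>s - D. of_bool (i = i0) :: real)"
      using single by (intro sum.cong) (auto split: if_splits simp: of_bool_def)
    then have T: "?T = 1"
      using single assms by (simp add: of_bool_def sum.delta)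
    show ?thesis
      unfolding T W using single by (auto simp: row_weight_def score)
  next
    case other
    have T: "?T = 0"
      using other by (intro sum.neutral) auto
    have "row_score D s c y = 0" for c
    proof -
      have "(\<Sum>j\<in>D - s. of_bool (y j \<and> (\<forall>i\<in>s. \<not> y i))) = (0 :: real)"
        using other by (intro sum.neutral) auto
      moreover have "(\<Sum>i\<in>s - D. of_bool (\<forall>i'\<in>s. y i' = (i' = i))) = (0 :: real)"
        using other by (intro sum.neutral) auto
      ultimately show ?thesis by (simp add: row_score_def)
    qed
    then show ?thesis
      unfolding T W using other by (auto simp: row_weight_def)
  qed
qed

lemma prod_delta_power:
  fixes x z :: real
  assumes "finite C" "i \<in> C"
  shows "(\<Prod>i'\<in>C. if i' = i then x else z) = x * z ^ (card C - 1)"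
proof -
  have "(\<Prod>i'\<in>C. if i' = i then x else z) = x * (\<Prod>i'\<in>C - {i}. if i' = i then x else z)"
    using assms by (subst prod.remove[of _ i]) auto
  also have "(\<Prod>i'\<in>C - {i}. if i' = i then x else z) = (\<Prod>i'\<in>C - {i}. z)"
    by (intro prod.cong) auto
  finally show ?thesis using assms by simp
qed

lemma expectation_row_weight:
  fixes q l :: real
  assumes fin: "finite B" and sub: "D \<subseteq> B" "s \<subseteq> B" and q: "q \<in> {0<..<1}"
  shows "measure_pmf.expectation (Pi_pmf B d (\<lambda>_. bernoulli_pmf q)) (row_weight q l D s) =
    row_mgf q l (card s) (card (s - D)) (card (D - s))"
proof -
  let ?E = "measure_pmf.expectation (Pi_pmf B d (\<lambda>_. bernoulli_pmf q))"
  have q': "q \<in> {0..1}" using q by auto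
  have fD: "finite D" and fs: "finite s" using assms finite_subset by blast+
  define w where "w = exp (- (l * (card (s - D) / card (D - s))))"
  have int: "integrable (Pi_pmf B d (\<lambda>_. bernoulli_pmf q)) f" for f :: "(nat \<Rightarrow> bool) \<Rightarrow> real"
    using fin by (intro integrable_measure_pmf_finite finite_set_Pi_pmf) auto
  have U: "card (s \<union> D) = card D + card (s - D)" "card (s \<union> D) = card s + card (D - s)"
    using fD fs by (auto simp flip: card_Un_disjoint intro!: arg_cong[where f = card])
  have E1: "?E (\<lambda>y. of_bool (\<forall>i\<in>C. y i = False)) = (1 - q) ^ card C" if "C \<subseteq> B" for C
    using expectation_pattern_bernoulli[OF fin that q', of d "\<lambda>_. False"] by simp
  have E2: "?E (\<lambda>y. of_bool (\<forall>i'\<in>C. y i' = (i' = i))) = q * (1 - q) ^ (card C - 1)"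
    if "C \<subseteq> B" "i \<in> C" for C i
    using expectation_pattern_bernoulli[OF fin that(1) q', of d "\<lambda>i'. i' = i"] that fin finite_subset
    by (subst (asm) prod_delta_power) auto
  have E3: "?E (\<lambda>y. \<Prod>i\<in>s \<union> D. if i \<in> s then of_bool (\<not> y i) else if y i then w else 1) =
      (1 - q) ^ card s * (1 - q + q * w) ^ card (D - s)"
  proof -
    have "?E (\<lambda>y. \<Prod>i\<in>s \<union> D. if i \<in> s then of_bool (\<not> y i) else if y i then w else 1) =
      (\<Prod>i\<in>s \<union> D. q * (if i \<in> s then of_bool (\<not> True) else if True then w else 1) +
        (1 - q) * (if i \<in> s then of_bool (\<not> False) else if False then w else 1))"
      using sub fin by (intro expectation_prod_bernoulli[OF fin _ q', where g = "\<lambda>i b. if i \<in> s then of_bool (\<not> b) else if b then w else 1"]) (auto simp: w_def)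
    also have "\<dots> = (\<Prod>i\<in>s \<union> (D - s). if i \<in> s then 1 - q else 1 - q + q * w)"
      by (intro prod.cong) auto
    also have "\<dots> = (\<Prod>i\<in>s. 1 - q) * (\<Prod>i\<in>D - s. 1 - q + q * w)"
      using fD fs by (subst prod.union_disjoint) (auto intro!: arg_cong2[where f = "(*)"] prod.cong)
    finally show ?thesis by simp
  qed
  have "?E (row_weight q l D s) =
     (1 - q) ^ card (s \<union> D) / (1 - q) ^ card (s - D) + 1 - (1 - q) ^ card D +
     (1 - q) ^ card s * (1 - q + q * w) ^ card (D - s) - (1 - q) ^ card s +
     (exp l - 1) * (\<Sum>i\<in>s - D. q * (1 - q) ^ (card s - 1) - q * (1 - q) ^ (card (s \<union> D) - 1))"
    unfolding row_weight_expand[OF fD fs, where q = q and l = l, folded w_def]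
    using sub by (simp add: int E1 E2 E3 del: eq_False)
  \<comment> \<open>The quotient in the first term equals \<open>(1 - q) ^ card D\<close> and
    cancels the third term; this is the effect of the normalisation in
    \<open>row_weight\<close>.\<close>
  also have "\<dots> = 1 + (1 - q) ^ card s * ((1 - q + q * w) ^ card (D - s) - 1) +
     (exp l - 1) * (card (s - D) * (q * (1 - q) ^ (card s - 1) - q * (1 - q) ^ (card (s \<union> D) - 1)))"
    using q by (simp add: U(1) power_add algebra_simps)
  also have "\<dots> = row_mgf q l (card s) (card (s - D)) (card (D - s))"
  proof (cases "card s = 0")
    case True
    then show ?thesis using fs by (simp add: row_mgf_def w_def)
  next
    case False
    then have "card (s \<union> D) - 1 = (card s - 1) + card (D - s)"
      using U(2) by simp
    then show ?thesis
      by (simp add: row_mgf_def w_def power_add algebra_simps)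
  qed
  finally show ?thesis .
qed

section \<open>Local optimality\<close>

lemma D_subset_PD: "D \<subseteq> {..<p} \<Longrightarrow> D \<subseteq> PD p n D X"
  by (auto simp: PD_def positive_test_def contains_item_of_def)

text \<open>A defective \<open>j\<close> lies in \<open>PD\<close>, so the swap is admissible, and
  every test containing \<open>j\<close> is positive, so each test counted on the left becomes
  explained. The loss is only bounded from above: a test in which \<open>i\<close> was alone may
  contain \<open>j\<close> as well.\<close>

lemma gain_le_loss:
  assumes bad: "bad_local_minimum p k n \<delta> \<epsilon> D X s" and "D \<subseteq> {..<p}"
    and i: "i \<in> s" and j: "j \<in> D - s"
  shows "card {t \<in> {..<n}. X (t, j) \<and> (\<forall>i\<in>s. \<not> X (t, i))} \<le>
    card {t \<in> {..<n}. \<forall>i'\<in>s. X (t, i') = (i' = i)}"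
proof -
  let ?G = "{t \<in> {..<n}. X (t, j) \<and> (\<forall>i\<in>s. \<not> X (t, i))}"
  let ?L = "{t \<in> {..<n}. \<forall>i'\<in>s. X (t, i') = (i' = i)}"
  let ?\<tau> = "(s \<union> {j}) - {i}"
  let ?E = "\<lambda>s. {t \<in> {..<n}. positive_test D X t \<and> contains_item_of X t s}"
  have "?\<tau> \<in> swaps p n D X s"
    using i j D_subset_PD[OF \<open>D \<subseteq> {..<p}\<close>, of n X] by (auto simp: swaps_def)
  then have "card (?E ?\<tau>) \<le> card (?E s)"
    using bad by (fastforce simp: bad_local_minimum_def explained_def)
  \<comment> \<open>Explained tests outside \<open>?L\<close> contain an item of \<open>s\<close>
    other than \<open>i\<close> and survive the swap; those in \<open>?G\<close> miss
    \<open>s\<close>, so the two families are disjoint.\<close>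
  moreover have "card (?E s - ?L) + card ?G \<le> card (?E ?\<tau>)"
  proof -
    have "card (?E s - ?L) + card ?G = card ((?E s - ?L) \<union> ?G)"
      by (rule card_Un_disjoint[symmetric]) (auto simp: contains_item_of_def)
    also have "\<dots> \<le> card (?E ?\<tau>)"
      using i j by (intro card_mono) (auto simp: contains_item_of_def positive_test_def)
    finally show ?thesis .
  qed
  moreover have "card (?E s) - card ?L \<le> card (?E s - ?L)"
    by (intro diff_card_le_card_Diff) auto
  ultimately show ?thesis by linarith
qed

lemma sum_row_score_nonneg:
  assumes bad: "bad_local_minimum p k n \<delta> \<epsilon> D X s" and D: "D \<subseteq> {..<p}" and s: "finite s"
    and ne: "D - s \<noteq> {}"
  shows "0 \<le> (\<Sum>t<n. row_score D s (card (s - D) / card (D - s)) (\<lambda>i. X (t, i)))"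
proof -
  let ?G = "\<lambda>j. real (card {t \<in> {..<n}. X (t, j) \<and> (\<forall>i\<in>s. \<not> X (t, i))})"
  let ?L = "\<lambda>i. real (card {t \<in> {..<n}. \<forall>i'\<in>s. X (t, i') = (i' = i)})"
  define m u where "m = card (s - D)" and "u = card (D - s)"
  have u: "u > 0"
    using ne D finite_subset[OF D] by (auto simp: u_def card_gt_0_iff)
  have "(\<Sum>t<n. row_score D s (m / u) (\<lambda>i. X (t, i))) =
      (\<Sum>i\<in>s - D. ?L i) - m / u * (\<Sum>j\<in>D - s. ?G j)"
    unfolding row_score_def sum_subtractf sum_distrib_left[symmetric]
    by (subst (1 2) sum.swap) (simp add: Int_def)
  \<comment> \<open>\<open>gain_le_loss\<close> is summed over all \<open>m * u\<close> pairs: each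
    gain occurs \<open>m\<close> times and each loss \<open>u\<close> times.\<close>
  moreover have "m * (\<Sum>j\<in>D - s. ?G j) \<le> u * (\<Sum>i\<in>s - D. ?L i)"
  proof -
    have "m * (\<Sum>j\<in>D - s. ?G j) = (\<Sum>i\<in>s - D. \<Sum>j\<in>D - s. ?G j)"
      by (simp add: m_def)
    also have "\<dots> \<le> (\<Sum>i\<in>s - D. \<Sum>j\<in>D - s. ?L i)"
      using gain_le_loss[OF bad D] by (intro sum_mono) auto
    also have "\<dots> = u * (\<Sum>i\<in>s - D. ?L i)"
      by (simp add: u_def sum_distrib_left)
    finally show ?thesis .
  qed
  then have "m / u * (\<Sum>j\<in>D - s. ?G j) \<le> (\<Sum>i\<in>s - D. ?L i)"
    using u by (simp add: pos_divide_le_eq mult.commute)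
  ultimately show ?thesis
    unfolding m_def[symmetric] u_def[symmetric] by linarith
qed

text \<open>The scores sum to a nonnegative number, so with \<open>l \<ge> 0\<close> the exponential
  factors multiply to at least 1. Each negative test contributes exactly
  \<open>1 / (1 - q) ^ m\<close>, because no item of a subset of \<open>PD\<close> takes part in it,
  and at least \<open>c\<close> such factors are present.\<close>

lemma prod_row_weight_ge:
  fixes q l :: real
  assumes bad: "bad_local_minimum p k n \<delta> \<epsilon> D X s" and D: "D \<subseteq> {..<p}" and s: "finite s"
    and ne: "D - s \<noteq> {}" and q: "q \<in> {0<..<1}" and l: "l \<ge> 0"
    and c: "c \<le> card {t \<in> {..<n}. \<not> positive_test D X t}"
  shows "1 / (1 - q) ^ (card (s - D) * c) \<le> (\<Prod>t<n. row_weight q l D s (\<lambda>i. X (t, i)))"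
proof -
  define m u where "m = card (s - D)" and "u = card (D - s)"
  let ?S = "\<lambda>t. row_score D s (m / u) (\<lambda>i. X (t, i))"
  have sPD: "s \<subseteq> PD p n D X"
    using bad by (auto simp: bad_local_minimum_def states_def)
  have row: "row_weight q l D s (\<lambda>i. X (t, i)) =
      exp (l * ?S t) * (if positive_test D X t then 1 else 1 / (1 - q) ^ m)" if "t < n" for t
  proof (cases "positive_test D X t")
    case True
    then show ?thesis
      by (auto simp: row_weight_def positive_test_def contains_item_of_def m_def u_def)
  next
    case False
    then have no: "\<not> X (t, i)" if "i \<in> s \<union> D" for i
      using that sPD \<open>t < n\<close> by (auto simp: PD_def positive_test_def contains_item_of_def)
    have "?S t = 0"
      using no unfolding row_score_def by (subst (1 2) sum.neutral) auto
    with False no show ?thesis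
      by (auto simp: row_weight_def m_def)
  qed
  have r: "0 < (1 - q) ^ m" "(1 - q) ^ m \<le> 1"
    using q by (auto intro: power_le_one)
  define N where "N = card {t \<in> {..<n}. \<not> positive_test D X t}"
  have "(\<Prod>t<n. row_weight q l D s (\<lambda>i. X (t, i))) =
      (\<Prod>t<n. exp (l * ?S t)) * (\<Prod>t<n. if positive_test D X t then 1 else 1 / (1 - q) ^ m)"
    unfolding prod.distrib[symmetric] by (intro prod.cong) (auto simp: row)
  also have "(\<Prod>t<n. exp (l * ?S t)) = exp (l * (\<Sum>t<n. ?S t))"
    by (simp add: exp_sum sum_distrib_left)
  also have "(\<Prod>t<n. if positive_test D X t then 1 else 1 / (1 - q) ^ m) = 1 / ((1 - q) ^ m) ^ N"
    by (subst prod.If_cases) (auto simp: N_def Int_def power_one_over)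
  finally have eq: "(\<Prod>t<n. row_weight q l D s (\<lambda>i. X (t, i))) =
      exp (l * (\<Sum>t<n. ?S t)) * (1 / ((1 - q) ^ m) ^ N)" .
  have "1 / ((1 - q) ^ m) ^ c \<le> 1 / ((1 - q) ^ m) ^ N"
    using r c by (intro divide_left_mono power_decreasing) (auto simp: N_def)
  also have "\<dots> = 1 * (1 / ((1 - q) ^ m) ^ N)"
    by simp
  also have "\<dots> \<le> exp (l * (\<Sum>t<n. ?S t)) * (1 / ((1 - q) ^ m) ^ N)"
  proof (rule mult_right_mono)
    show "1 \<le> exp (l * (\<Sum>t<n. ?S t))"
      using sum_row_score_nonneg[OF bad D s ne] l by (simp add: m_def u_def)
    show "0 \<le> 1 / ((1 - q) ^ m) ^ N"
      using r by simp
  qed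
  finally show ?thesis
    unfolding eq by (simp add: power_mult m_def)
qed

text \<open>Markov's inequality at the threshold from \<open>prod_row_weight_ge\<close>; dividing by
  the threshold produces the price \<open>(1 - q) ^ (card (s - D) * c)\<close> of the inclusion in
  \<open>PD\<close>.\<close>

lemma prob_bad_local_minimum_le:
  fixes q l :: real
  assumes D: "D \<subseteq> {..<p}" and s: "s \<subseteq> {..<p}"
    and ne: "D - s \<noteq> {}" and q: "q \<in> {0<..<1}" and l: "l \<ge> 0"
  shows "measure_pmf.prob (Pi_pmf ({..<n} \<times> {..<p}) False (\<lambda>_. bernoulli_pmf q))
      {X. bad_local_minimum p k n \<delta> \<epsilon> D X s \<and> c \<le> card {t \<in> {..<n}. \<not> positive_test D X t}} \<le>
    (1 - q) ^ (card (s - D) * c) * row_mgf q l (card s) (card (s - D)) (card (D - s)) ^ n"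
proof -
  have fs: "finite s" using s finite_subset by blast
  have "measure_pmf.prob (Pi_pmf ({..<n} \<times> {..<p}) False (\<lambda>_. bernoulli_pmf q))
      {X. bad_local_minimum p k n \<delta> \<epsilon> D X s \<and> c \<le> card {t \<in> {..<n}. \<not> positive_test D X t}} \<le>
    measure_pmf.expectation (Pi_pmf {..<p} False (\<lambda>_. bernoulli_pmf q)) (row_weight q l D s) ^
      card {..<n} / (1 / (1 - q) ^ (card (s - D) * c))"
    using q prod_row_weight_ge[OF _ D fs ne q l] row_weight_nonneg
    by (intro prob_rows_le) auto
  then show ?thesis
    using expectation_row_weight[OF _ D s q] by (simp add: mult.commute)
qed

text \<open>Chernoff's lower tail bound, with \<open>\<rho>\<close> the probability that a single
  test is negative. It holds for every positive \<open>\<eta>\<close>, so the later choice of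
  \<open>\<eta>\<close> only has to be positive.\<close>

lemma prob_few_negative_le:
  fixes q \<eta> :: real
  assumes D: "D \<subseteq> {..<p}" and q: "q \<in> {0<..<1}" and \<eta>: "\<eta> > 0"
  defines "\<rho> \<equiv> (1 - q) ^ card D"
  shows "measure_pmf.prob (Pi_pmf ({..<n} \<times> {..<p}) False (\<lambda>_. bernoulli_pmf q))
      {X. real (card {t \<in> {..<n}. \<not> positive_test D X t}) < (1 - \<eta>) * n * \<rho>} \<le>
    exp (- (\<eta>\<^sup>2 / 2 * \<rho> * n))"
proof -
  \<comment> \<open>The weight \<open>exp (- \<eta>)\<close> on negative tests and 1 on positive
    ones, in a form that is affine in one pattern indicator.\<close>
  let ?h = "\<lambda>y. 1 - (1 - exp (- \<eta>)) * of_bool (\<forall>i\<in>D. y i = False)"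
  let ?P = "Pi_pmf {..<p} False (\<lambda>_. bernoulli_pmf q)"
  have \<rho>: "0 < \<rho>" "\<rho> \<le> 1"
    using q by (auto simp: \<rho>_def intro: power_le_one)
  have E: "measure_pmf.expectation ?P ?h = 1 - (1 - exp (- \<eta>)) * \<rho>"
  proof -
    have int: "integrable ?P f" for f :: "(nat \<Rightarrow> bool) \<Rightarrow> real"
      by (intro integrable_measure_pmf_finite finite_set_Pi_pmf) auto
    show ?thesis
      using expectation_pattern_bernoulli[OF _ D, of q False "\<lambda>_. False"] q
      by (simp add: int \<rho>_def)
  qed
  have *: "exp (- (\<eta> * ((1 - \<eta>) * n * \<rho>))) \<le> (\<Prod>t<n. ?h (\<lambda>i. X (t, i)))"
    if "real (card {t \<in> {..<n}. \<not> positive_test D X t}) < (1 - \<eta>) * n * \<rho>" for X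
  proof -
    have "(\<Prod>t<n. ?h (\<lambda>i. X (t, i))) = (\<Prod>t<n. if positive_test D X t then 1 else exp (- \<eta>))"
      by (intro prod.cong) (auto simp: positive_test_def contains_item_of_def)
    also have "\<dots> = exp (- \<eta>) ^ card {t \<in> {..<n}. \<not> positive_test D X t}"
      by (subst prod.If_cases) (auto simp: Int_def)
    also have "\<dots> = exp (- (\<eta> * card {t \<in> {..<n}. \<not> positive_test D X t}))"
      by (simp add: exp_of_nat_mult[symmetric] mult.commute)
    finally show ?thesis
      using that \<eta> by simp
  qed
  have "measure_pmf.prob (Pi_pmf ({..<n} \<times> {..<p}) False (\<lambda>_. bernoulli_pmf q))
      {X. real (card {t \<in> {..<n}. \<not> positive_test D X t}) < (1 - \<eta>) * n * \<rho>} \<le>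
      measure_pmf.expectation ?P ?h ^ card {..<n} / exp (- (\<eta> * ((1 - \<eta>) * n * \<rho>)))"
    using \<eta> by (intro prob_rows_le *) (auto simp: of_bool_def)
  also have "\<dots> \<le> exp (- (\<eta> - \<eta>\<^sup>2 / 2) * \<rho>) ^ n / exp (- (\<eta> * ((1 - \<eta>) * n * \<rho>)))"
  proof -
    \<comment> \<open>Taylor's formula with a cubic remainder, which is nonpositive because the cube
      of \<open>- \<eta>\<close> is negative.\<close>
    have "exp (- \<eta>) \<le> 1 - \<eta> + \<eta>\<^sup>2 / 2"
    proof -
      have "\<exists>t. \<bar>t\<bar> \<le> \<bar>- \<eta>\<bar> \<and> exp (- \<eta>) = (\<Sum>m<3. (- \<eta>) ^ m / fact m) + exp t / fact 3 * (- \<eta>) ^ 3"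
        by (rule Maclaurin_exp_le)
      then obtain t where "exp (- \<eta>) = (\<Sum>m<3. (- \<eta>) ^ m / fact m) + exp t / fact 3 * (- \<eta>) ^ 3"
        by blast
      moreover have "exp t / fact 3 * (- \<eta>) ^ 3 \<le> 0"
        using \<eta> by (simp add: power3_eq_cube)
      ultimately show ?thesis
        by (simp add: numeral_3_eq_3 power2_eq_square)
    qed
    then have "(\<eta> - \<eta>\<^sup>2 / 2) * \<rho> \<le> (1 - exp (- \<eta>)) * \<rho>"
      using \<rho> by (intro mult_right_mono) auto
    then have "1 - (1 - exp (- \<eta>)) * \<rho> \<le> 1 + (- (\<eta> - \<eta>\<^sup>2 / 2) * \<rho>)"
      by (simp add: algebra_simps)
    also have "\<dots> \<le> exp (- (\<eta> - \<eta>\<^sup>2 / 2) * \<rho>)"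
      by (rule exp_ge_add_one_self)
    finally have le: "1 - (1 - exp (- \<eta>)) * \<rho> \<le> exp (- (\<eta> - \<eta>\<^sup>2 / 2) * \<rho>)" .
    have "(1 - exp (- \<eta>)) * \<rho> \<le> 1"
      using \<rho> \<eta> by (intro mult_le_one) auto
    then show ?thesis
      unfolding E card_lessThan using le by (intro divide_right_mono power_mono) auto
  qed
  also have "\<dots> = exp (- (\<eta>\<^sup>2 / 2 * \<rho> * n))"
    by (simp add: exp_of_nat_mult[symmetric] exp_diff[symmetric] power2_eq_square algebra_simps)
  finally show ?thesis .
qed

section \<open>Union bound\<close>

text \<open>Conditioning on the first component: a bound that is uniform over its support survives
  averaging. This allows the defective set to be held fixed in all estimates.\<close>

lemma prob_pair_pmf_le:
  assumes "\<And>a. a \<in> set_pmf M \<Longrightarrow> measure_pmf.prob N {b. P a b} \<le> c"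
  shows "measure_pmf.prob (pair_pmf M N) {(a, b). P a b} \<le> c"
proof -
  have c: "c \<ge> 0"
    using assms set_pmf_not_empty[of M] by (meson all_not_in_conv measure_nonneg order_trans)
  have "emeasure (pair_pmf M N) {(a, b). P a b} =
      (\<integral>\<^sup>+a. emeasure (measure_pmf N) {b. P a b} \<partial>measure_pmf M)"
    unfolding pair_pmf_def
    by (simp add: indicator_def nn_integral_indicator[symmetric] del: nn_integral_indicator)
  also have "\<dots> \<le> (\<integral>\<^sup>+a. ennreal c \<partial>measure_pmf M)"
    using assms by (intro nn_integral_mono_AE AE_pmfI)
      (auto simp: measure_pmf.emeasure_eq_measure intro: ennreal_leI)
  finally show ?thesis
    using c by (simp add: measure_pmf.emeasure_eq_measure)
qed

text \<open>Derived from the formula and not from a mean of nonnegative weights, because the bound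
  must also make sense for sizes that no set \<open>s\<close> realises. The negative term
  \<open>- (1 - q) ^ a\<close> is absorbed by the leading 1.\<close>

lemma row_mgf_nonneg:
  assumes "q \<in> {0..1}" "l \<ge> 0"
  shows "row_mgf q l a m u \<ge> 0"
proof -
  have "0 \<le> (1 - q) ^ a * (1 - q + q * exp (- (l * (m / u)))) ^ u"
    using assms by (intro mult_nonneg_nonneg zero_le_power add_nonneg_nonneg) auto
  moreover have "(1 - q) ^ a \<le> 1" "(1 - q) ^ u \<le> 1"
    using assms by (auto intro!: power_le_one)
  moreover from this have "0 \<le> m * q * (1 - q) ^ (a - 1) * (1 - (1 - q) ^ u) * (exp l - 1)"
    using assms by (intro mult_nonneg_nonneg) auto
  ultimately show ?thesis
    by (simp add: row_mgf_def right_diff_distrib)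
qed

text \<open>A set is determined by its parts inside and outside \<open>D\<close>. Allowing all
  \<open>2 ^ card D\<close> inner parts is crude, but for \<open>card D = k\<close> this factor is
  negligible on the scale \<open>k * ln (p / k)\<close>.\<close>

lemma card_subsets_overlap_le:
  assumes "finite A" "finite D"
  shows "card {s. s \<subseteq> A \<and> card s = a \<and> card (s \<inter> D) = b} \<le> 2 ^ card D * (card A choose (a - b))"
proof -
  have "inj_on (\<lambda>s. (s \<inter> D, s - D)) {s. s \<subseteq> A \<and> card s = a \<and> card (s \<inter> D) = b}"
    by (rule inj_onI) auto
  then have "card {s. s \<subseteq> A \<and> card s = a \<and> card (s \<inter> D) = b} \<le>
      card (Pow D \<times> {s. s \<subseteq> A \<and> card s = a - b})"
  proof (rule card_inj_on_le)
    show "(\<lambda>s. (s \<inter> D, s - D)) ` {s. s \<subseteq> A \<and> card s = a \<and> card (s \<inter> D) = b} \<subseteq>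
        Pow D \<times> {s. s \<subseteq> A \<and> card s = a - b}"
      using assms by (auto simp: card_Diff_subset_Int Int_commute intro: finite_subset)
    show "finite (Pow D \<times> {s. s \<subseteq> A \<and> card s = a - b})"
      using assms by simp
  qed
  also have "\<dots> = 2 ^ card D * (card A choose (a - b))"
    using assms by (simp add: card_cartesian_product card_Pow n_subsets)
  finally show ?thesis .
qed

text \<open>Either the number of negative tests falls below the Chernoff threshold, or some
  \<open>s\<close> realises \<open>?G s\<close>. The union runs over the overlaps \<open>b\<close>,
  at most \<open>k\<close> of them, and then over the sets with that overlap; \<open>B\<close>
  dominates the contribution of each overlap.\<close>

lemma prob_exists_bad_local_minimum_le:
  fixes q l \<eta> \<delta> \<epsilon> B :: real and n k :: nat
  assumes D: "D \<subseteq> {..<p}" "card D = k"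
    and q: "q \<in> {0<..<1}" and l: "l \<ge> 0" and \<eta>: "\<eta> > 0" and \<delta>: "\<delta> \<ge> 0"
  defines "k' \<equiv> nat \<lfloor>(1 + \<epsilon>) * real k\<rfloor>"
    and "c \<equiv> nat \<lceil>(1 - \<eta>) * n * (1 - q) ^ k\<rceil>"
  assumes B0: "B \<ge> 0" and B: "\<And>b. int b < \<lfloor>(1 - \<delta>) * real k\<rfloor> \<Longrightarrow>
    2 ^ k * (p choose (k' - b)) * ((1 - q) ^ ((k' - b) * c) * row_mgf q l k' (k' - b) (k - b) ^ n) \<le> B"
  shows "measure_pmf.prob (Pi_pmf ({..<n} \<times> {..<p}) False (\<lambda>_. bernoulli_pmf q))
      {X. \<exists>s. bad_local_minimum p k n \<delta> \<epsilon> D X s} \<le>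
    exp (- (\<eta>\<^sup>2 / 2 * (1 - q) ^ k * n)) + k * B"
proof -
  let ?M = "Pi_pmf ({..<n} \<times> {..<p}) False (\<lambda>_. bernoulli_pmf q)"
  let ?N = "\<lambda>X. card {t \<in> {..<n}. \<not> positive_test D X t}"
  let ?F = "{X. real (?N X) < (1 - \<eta>) * n * (1 - q) ^ card D}"
  let ?G = "\<lambda>s. {X. bad_local_minimum p k n \<delta> \<epsilon> D X s \<and> c \<le> ?N X}"
  define S where "S b = {s. s \<subseteq> {..<p} \<and> card s = k' \<and> card (s \<inter> D) = b}" for b
  define I where "I = {b. int b < \<lfloor>(1 - \<delta>) * real k\<rfloor>}"
  have fD: "finite D" using D finite_subset by blast
  have fS: "finite (S b)" for b
    unfolding S_def by (rule finite_subset[of _ "Pow {..<p}"]) auto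
  \<comment> \<open>Strictness makes \<open>D - s\<close> nonempty below, as the averaging over
    \<open>D - s\<close> requires.\<close>
  have I: "b < k" if "b \<in> I" for b
  proof -
    have "real b < (1 - \<delta>) * real k"
      using that unfolding I_def less_floor_iff by auto
    also have "\<dots> \<le> 1 * real k"
      using \<delta> by (intro mult_right_mono) auto
    finally show ?thesis by simp
  qed
  then have Isub: "I \<subseteq> {..<k}" by auto
  have fI: "finite I" using Isub finite_subset by blast
  have bound: "measure_pmf.prob ?M (?G s) \<le>
      (1 - q) ^ ((k' - b) * c) * row_mgf q l k' (k' - b) (k - b) ^ n" if "s \<in> S b" "b \<in> I" for s b
  proof -
    have s: "s \<subseteq> {..<p}" "card s = k'" "card (s \<inter> D) = b" "finite s"
      using that finite_subset by (auto simp: S_def)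
    have cards: "card (s - D) = k' - b" "card (D - s) = k - b"
      using s fD D by (simp_all add: card_Diff_subset_Int Int_commute)
    have "D - s \<noteq> {}"
      using I[OF that(2)] cards by (metis card.empty zero_less_diff less_irrefl)
    then show ?thesis
      using prob_bad_local_minimum_le[OF D(1) s(1) _ q l, of n k \<delta> \<epsilon> c] s cards by simp
  qed
  have cover: "{X. \<exists>s. bad_local_minimum p k n \<delta> \<epsilon> D X s} \<subseteq> ?F \<union> (\<Union>b\<in>I. \<Union>s\<in>S b. ?G s)"
  proof
    fix X assume "X \<in> {X. \<exists>s. bad_local_minimum p k n \<delta> \<epsilon> D X s}"
    then obtain s where s: "bad_local_minimum p k n \<delta> \<epsilon> D X s" by auto
    have "s \<in> S (card (s \<inter> D))" "card (s \<inter> D) \<in> I"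
      using s by (auto simp: bad_local_minimum_def states_def PD_def S_def I_def k'_def)
    moreover have "c \<le> ?N X" if "X \<notin> ?F"
    proof -
      have "(1 - \<eta>) * n * (1 - q) ^ k \<le> real (?N X)"
        using that D by simp
      then show ?thesis unfolding c_def by linarith
    qed
    ultimately show "X \<in> ?F \<union> (\<Union>b\<in>I. \<Union>s\<in>S b. ?G s)"
      using s by blast
  qed
  have "measure_pmf.prob ?M {X. \<exists>s. bad_local_minimum p k n \<delta> \<epsilon> D X s} \<le>
      measure_pmf.prob ?M (?F \<union> (\<Union>b\<in>I. \<Union>s\<in>S b. ?G s))"
    using cover by (intro measure_pmf.finite_measure_mono) auto
  also have "\<dots> \<le> measure_pmf.prob ?M ?F + measure_pmf.prob ?M (\<Union>b\<in>I. \<Union>s\<in>S b. ?G s)"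
    by (intro measure_Un_le) auto
  also have "measure_pmf.prob ?M ?F \<le> exp (- (\<eta>\<^sup>2 / 2 * (1 - q) ^ k * n))"
    using prob_few_negative_le[OF D(1) q \<eta>, of n] D by simp
  also have "measure_pmf.prob ?M (\<Union>b\<in>I. \<Union>s\<in>S b. ?G s) \<le> (\<Sum>b\<in>I. measure_pmf.prob ?M (\<Union>s\<in>S b. ?G s))"
    using fI by (intro measure_pmf.finite_measure_subadditive_finite) auto
  also have "\<dots> \<le> (\<Sum>b\<in>I. B)"
  proof (rule sum_mono)
    fix b assume b: "b \<in> I"
    let ?T = "(1 - q) ^ ((k' - b) * c) * row_mgf q l k' (k' - b) (k - b) ^ n"
    have "measure_pmf.prob ?M (\<Union>s\<in>S b. ?G s) \<le> (\<Sum>s\<in>S b. measure_pmf.prob ?M (?G s))"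
      using fS by (intro measure_pmf.finite_measure_subadditive_finite) auto
    also have "\<dots> \<le> card (S b) * ?T"
      using bound[OF _ b] by (intro sum_bounded_above) auto
    also have "\<dots> \<le> real (2 ^ k * (p choose (k' - b))) * ?T"
    proof (cases "S b = {}")
      case True
      moreover have "row_mgf q l k' (k' - b) (k - b) \<ge> 0"
        using q l by (intro row_mgf_nonneg) auto
      ultimately show ?thesis
        using q by simp
    next
      case False
      then obtain s where "s \<in> S b" by auto
      then have "0 \<le> ?T"
        using bound[OF _ b, of s] measure_nonneg order_trans by blast
      then show ?thesis
        using card_subsets_overlap_le[OF _ fD, of "{..<p}" k' b] D
        by (intro mult_right_mono of_nat_mono) (auto simp: S_def)
    qed
    also have "\<dots> \<le> B"
      using B[of b] b by (simp add: I_def)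
    finally show "measure_pmf.prob ?M (\<Union>s\<in>S b. ?G s) \<le> B" .
  qed
  also have "\<dots> \<le> k * B"
    using card_mono[OF _ Isub] B0 by (simp add: mult_right_mono)
  finally show ?thesis by simp
qed

section \<open>The limiting moment generating function\<close>

text \<open>\<open>m ^ m / fact m\<close> is a single term of the series of \<open>exp m\<close>,
  and \<open>(n choose m) * fact m\<close> is at most \<open>n ^ m\<close>.\<close>

lemma binomial_le_exp_pow:
  assumes "m > 0"
  shows "real (n choose m) \<le> (exp 1 * n / m) ^ m"
proof -
  have "real m ^ m /\<^sub>R fact m \<le> exp (real m)"
  proof -
    have "(\<Sum>i\<in>{m}. real m ^ i /\<^sub>R fact i) \<le> (\<Sum>i. real m ^ i /\<^sub>R fact i)"
      using exp_converges[of "real m"] by (intro sum_le_suminf) (auto simp: sums_iff)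
    then show ?thesis
      using exp_converges[of "real m"] by (simp add: sums_iff)
  qed
  then have m: "real m ^ m \<le> exp 1 ^ m * fact m"
    by (simp add: field_simps exp_of_nat_mult[symmetric])
  have "real (n choose m) * (real m ^ m) \<le> real (n choose m) * (exp 1 ^ m * fact m)"
    using m by (intro mult_left_mono) auto
  also have "\<dots> = exp 1 ^ m * real ((n choose m) * fact m)"
    by simp
  also have "\<dots> \<le> exp 1 ^ m * real (n ^ m)"
    using binomial_fact_pow[of n m] by (intro mult_left_mono of_nat_mono) auto
  finally show ?thesis
    using assms by (simp add: field_simps power_mult_distrib power_divide)
qed

text \<open>If \<open>x < y\<close>, this is the Lipschitz bound with constant 1 for the decaying
  exponential on the nonnegative axis; otherwise it is monotonicity.\<close>

lemma exp_minus_le: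
  fixes x y :: real
  assumes "x \<ge> 0"
  shows "exp (- x) \<le> exp (- y) + \<bar>x - y\<bar>"
proof (cases "x \<ge> y")
  case True
  then show ?thesis by (simp add: add_increasing2)
next
  case False
  have "exp (- x) - exp (- y) = exp (- x) * (1 - exp (- (y - x)))"
    by (simp add: right_diff_distrib exp_add[symmetric])
  also have "\<dots> \<le> 1 * (1 - exp (- (y - x)))"
    using assms False by (intro mult_right_mono) auto
  also have "\<dots> \<le> y - x"
    using exp_ge_add_one_self[of "x - y"] by (simp del: exp_ge_add_one_self)
  finally show ?thesis using False by simp
qed

text \<open>An explicit error takes the place of a limit, since the estimate has to hold uniformly
  in the overlap. It comes from \<open>ln (1 - q) \<ge> - q - 2 * q * q\<close>.\<close>

lemma one_minus_power_ge:
  fixes q :: real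
  assumes "0 \<le> q" "q \<le> 1/2"
  shows "exp (- (u * q)) - 2 * real u * q\<^sup>2 \<le> (1 - q) ^ u"
proof -
  have "exp (- (u * q)) \<le> exp (- (u * q + 2 * real u * q\<^sup>2)) + \<bar>u * q - (u * q + 2 * real u * q\<^sup>2)\<bar>"
    using assms by (intro exp_minus_le) auto
  also have "\<bar>u * q - (u * q + 2 * real u * q\<^sup>2)\<bar> = 2 * real u * q\<^sup>2"
    by simp
  also have "- (u * q + 2 * real u * q\<^sup>2) \<le> u * ln (1 - q)"
    using mult_left_mono[OF ln_one_minus_pos_lower_bound[OF assms], of "real u"]
    by (simp add: algebra_simps)
  then have "exp (- (u * q + 2 * real u * q\<^sup>2)) \<le> exp (u * ln (1 - q))"
    by simp
  also have "exp (u * ln (1 - q)) = (1 - q) ^ u"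
    using assms by (simp add: exp_of_nat_mult)
  finally show ?thesis by simp
qed

lemma one_minus_power_tendsto_exp:
  fixes k j :: "'a \<Rightarrow> nat" and \<nu> x :: real
  assumes k: "filterlim k at_top F" and j: "((\<lambda>p. real (j p) / real (k p)) \<longlongrightarrow> x) F" and "\<nu> > 0"
  shows "((\<lambda>p. (1 - \<nu> / k p) ^ j p) \<longlongrightarrow> exp (- \<nu> * x)) F"
proof -
  have kr: "filterlim (\<lambda>p. real (k p)) at_top F"
    using filterlim_compose[OF filterlim_real_sequentially k] .
  have "((\<lambda>y::real. y * ln (1 - \<nu> / y)) \<longlongrightarrow> - \<nu>) at_top"
    by real_asymp
  from filterlim_compose[OF this kr]
  have "((\<lambda>p. exp (k p * ln (1 - \<nu> / k p) * (real (j p) / real (k p)))) \<longlongrightarrow> exp (- \<nu> * x)) F"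
    by (intro tendsto_intros j)
  moreover have "\<forall>\<^sub>F p in F. real (k p) > \<nu>"
    using kr by (simp add: filterlim_at_top_dense)
  then have "\<forall>\<^sub>F p in F. exp (k p * ln (1 - \<nu> / k p) * (real (j p) / real (k p))) = (1 - \<nu> / k p) ^ j p"
  proof eventually_elim
    case (elim p)
    then have "1 - \<nu> / k p > 0" "k p > 0"
      using \<open>\<nu> > 0\<close> by (auto simp: field_simps intro: gr0I)
    then show ?case
      by (simp add: exp_of_nat2_mult)
  qed
  ultimately show ?thesis
    by (simp cong: tendsto_cong)
qed

text \<open>The argument of \<open>ln\<close> in \<open>Q\<close>; it is the limit of \<open>row_mgf\<close> for \<open>q = \<nu> / k\<close>.\<close>

definition limit_mgf :: "real \<Rightarrow> real \<Rightarrow> real \<Rightarrow> real \<Rightarrow> real" where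
  "limit_mgf l \<zeta> \<nu> \<epsilon> =
     exp (- \<nu> * (1 + \<epsilon>)) * (exp (\<nu> * (1 - \<zeta>) * (exp (- (l * (1 + \<epsilon> - \<zeta>) / (1 - \<zeta>))) - 1)) - 1)
     + (1 + \<epsilon> - \<zeta>) * \<nu> * exp (- \<nu> * (1 + \<epsilon>)) * (1 - exp (- \<nu> * (1 - \<zeta>))) * (exp l - 1) + 1"

lemma Q_limit_mgf: "Q l \<zeta> \<nu> \<epsilon> = - (ln (limit_mgf l \<zeta> \<nu> \<epsilon>) / ((1 + \<epsilon> - \<zeta>) * ln 2))"
  by (simp add: Q_def limit_mgf_def)

lemma limit_mgf_pos:
  assumes "\<nu> > 0" "\<epsilon> \<ge> 0" "\<zeta> < 1" "l \<ge> 0"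
  shows "limit_mgf l \<zeta> \<nu> \<epsilon> > 0"
proof -
  define A W where "A = exp (- \<nu> * (1 + \<epsilon>))"
    and "W = exp (\<nu> * (1 - \<zeta>) * (exp (- (l * (1 + \<epsilon> - \<zeta>) / (1 - \<zeta>))) - 1))"
  have "A < 1" "0 < A * W"
    using assms by (auto simp: A_def W_def add_pos_nonneg)
  then have "A * (W - 1) + 1 > 0"
    by (simp add: right_diff_distrib)
  moreover have "0 \<le> (1 + \<epsilon> - \<zeta>) * \<nu> * exp (- \<nu> * (1 + \<epsilon>)) * (1 - exp (- \<nu> * (1 - \<zeta>))) * (exp l - 1)"
    using assms by (intro mult_nonneg_nonneg) auto
  ultimately show ?thesis
    unfolding limit_mgf_def A_def W_def by linarith
qed

lemma limit_mgf_le: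
  assumes "\<nu> > 0" "\<epsilon> \<ge> 0" "0 \<le> \<zeta>" "\<zeta> < 1" "l \<ge> 0"
  shows "limit_mgf l \<zeta> \<nu> \<epsilon> \<le> (1 + \<epsilon>) * \<nu> * (exp l - 1) + 1"
proof -
  have "exp (- \<nu> * (1 + \<epsilon>)) * (exp (\<nu> * (1 - \<zeta>) * (exp (- (l * (1 + \<epsilon> - \<zeta>) / (1 - \<zeta>))) - 1)) - 1) \<le> 0"
    using assms by (intro mult_nonneg_nonpos) (auto intro!: mult_nonneg_nonpos)
  moreover have "(1 + \<epsilon> - \<zeta>) * \<nu> * exp (- \<nu> * (1 + \<epsilon>)) * (1 - exp (- \<nu> * (1 - \<zeta>))) * (exp l - 1) \<le>
      (1 + \<epsilon>) * \<nu> * 1 * 1 * (exp l - 1)"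
    using assms by (intro mult_right_mono mult_mono) (auto intro!: mult_nonneg_nonneg)
  ultimately show ?thesis
    by (simp add: limit_mgf_def)
qed

text \<open>Boundedness is what places the real-valued infimum below each of its elements. Here
  \<open>limit_mgf\<close> is bounded uniformly in \<open>\<zeta>\<close>, and the denominator stays
  away from 0 because \<open>1 + \<epsilon> - \<zeta> > \<delta>\<close>.\<close>

lemma bdd_below_Q:
  assumes "\<nu> > 0" "\<epsilon> \<ge> 0" "\<delta> > 0" "\<delta> \<le> 1" "l \<ge> 0"
  shows "bdd_below ((\<lambda>\<zeta>. Q l \<zeta> \<nu> \<epsilon>) ` {0..<1 - \<delta>})"
proof (rule bdd_belowI2)
  fix \<zeta> assume \<zeta>: "\<zeta> \<in> {0..<1 - \<delta>}"
  let ?U = "(1 + \<epsilon>) * \<nu> * (exp l - 1) + 1"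
  have U: "?U \<ge> 1" using assms by simp
  have "ln (limit_mgf l \<zeta> \<nu> \<epsilon>) \<le> ln ?U"
    using assms \<zeta> limit_mgf_le[of \<nu> \<epsilon> \<zeta> l] limit_mgf_pos[of \<nu> \<epsilon> \<zeta> l] by (intro ln_mono) auto
  then have "ln (limit_mgf l \<zeta> \<nu> \<epsilon>) / ((1 + \<epsilon> - \<zeta>) * ln 2) \<le> ln ?U / ((1 + \<epsilon> - \<zeta>) * ln 2)"
    using assms \<zeta> by (intro divide_right_mono) auto
  also have "\<dots> \<le> ln ?U / (\<delta> * ln 2)"
    using assms \<zeta> U by (intro divide_left_mono mult_right_mono mult_pos_pos) auto
  finally show "- (ln ?U / (\<delta> * ln 2)) \<le> Q l \<zeta> \<nu> \<epsilon>"
    by (simp add: Q_limit_mgf)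
qed

text \<open>Since \<open>R\<close> lies strictly below the threshold, one \<open>l\<close> can be
  fixed whose infimum still beats the rate. The slack \<open>\<gamma>\<close> is then shared by all
  \<open>\<zeta>\<close>, and undoing the logarithm in \<open>Q\<close> gives the exponential form
  that the union bound uses.\<close>

lemma rate_threshold_witness:
  assumes "\<nu> > 0" "\<epsilon> \<ge> 0" "\<delta> > 0" "\<delta> < 1" and R: "R < rate_threshold \<nu> \<delta> \<epsilon>"
  obtains l \<gamma> where "l \<ge> 0" "\<gamma> > 0"
    "\<And>\<zeta>. \<zeta> \<in> {0..<1 - \<delta>} \<Longrightarrow>
      limit_mgf l \<zeta> \<nu> \<epsilon> \<le> exp (- (1 + \<epsilon> - \<zeta>) * ((R + \<gamma>) * ln 2 - \<nu> * exp (- \<nu>)))"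
proof -
  have "R - \<nu> * exp (- \<nu>) / ln 2 < (SUP l\<in>{0..}. INF \<zeta>\<in>{0..<1 - \<delta>}. Q l \<zeta> \<nu> \<epsilon>)"
    using R by (simp add: rate_threshold_def)
  from less_cSupD[OF _ this] obtain l where l: "l \<ge> 0"
    and less: "R - \<nu> * exp (- \<nu>) / ln 2 < (INF \<zeta>\<in>{0..<1 - \<delta>}. Q l \<zeta> \<nu> \<epsilon>)"
    by auto
  define \<gamma> where "\<gamma> = (INF \<zeta>\<in>{0..<1 - \<delta>}. Q l \<zeta> \<nu> \<epsilon>) - (R - \<nu> * exp (- \<nu>) / ln 2)"
  show ?thesis
  proof (rule that[OF l])
    show "\<gamma> > 0" using less by (simp add: \<gamma>_def)
    fix \<zeta> assume \<zeta>: "\<zeta> \<in> {0..<1 - \<delta>}"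
    have "(INF \<zeta>\<in>{0..<1 - \<delta>}. Q l \<zeta> \<nu> \<epsilon>) \<le> Q l \<zeta> \<nu> \<epsilon>"
      using assms l \<zeta> by (intro cINF_lower bdd_below_Q) auto
    then have "R + \<gamma> - \<nu> * exp (- \<nu>) / ln 2 \<le> Q l \<zeta> \<nu> \<epsilon>"
      by (simp add: \<gamma>_def)
    moreover have z: "0 < 1 + \<epsilon> - \<zeta>"
      using assms \<zeta> by auto
    ultimately have "(1 + \<epsilon> - \<zeta>) * ln 2 * (R + \<gamma> - \<nu> * exp (- \<nu>) / ln 2) \<le> (1 + \<epsilon> - \<zeta>) * ln 2 * Q l \<zeta> \<nu> \<epsilon>"
      by (intro mult_left_mono) auto
    moreover have "(1 + \<epsilon> - \<zeta>) * ln 2 * Q l \<zeta> \<nu> \<epsilon> = - ln (limit_mgf l \<zeta> \<nu> \<epsilon>)"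
      using z by (simp add: Q_limit_mgf less_imp_neq)
    moreover have "(1 + \<epsilon> - \<zeta>) * ln 2 * (R + \<gamma> - \<nu> * exp (- \<nu>) / ln 2) =
        (1 + \<epsilon> - \<zeta>) * ((R + \<gamma>) * ln 2 - \<nu> * exp (- \<nu>))"
      by (simp add: field_simps)
    ultimately have "ln (limit_mgf l \<zeta> \<nu> \<epsilon>) \<le> - (1 + \<epsilon> - \<zeta>) * ((R + \<gamma>) * ln 2 - \<nu> * exp (- \<nu>))"
      by linarith
    then have "exp (ln (limit_mgf l \<zeta> \<nu> \<epsilon>)) \<le> exp (- (1 + \<epsilon> - \<zeta>) * ((R + \<gamma>) * ln 2 - \<nu> * exp (- \<nu>)))"
      unfolding exp_le_cancel_iff .
    moreover have "limit_mgf l \<zeta> \<nu> \<epsilon> > 0"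
      using assms l \<zeta> by (intro limit_mgf_pos) auto
    ultimately show "limit_mgf l \<zeta> \<nu> \<epsilon> \<le> exp (- (1 + \<epsilon> - \<zeta>) * ((R + \<gamma>) * ln 2 - \<nu> * exp (- \<nu>)))"
      by (simp only: exp_ln)
  qed
qed

section \<open>Uniform comparison of \<open>row_mgf\<close> with its limit\<close>

lemma floor_diff_bounds:
  fixes \<epsilon> :: real
  assumes "0 \<le> \<epsilon>" "b \<le> k"
  shows "real (nat \<lfloor>(1 + \<epsilon>) * real k\<rfloor> - b) \<le> (1 + \<epsilon>) * k - b"
    and "(1 + \<epsilon>) * k - b \<le> real (nat \<lfloor>(1 + \<epsilon>) * real k\<rfloor> - b) + 1"
proof -
  have "real b \<le> (1 + \<epsilon>) * real k"
    using mult_mono[of 1 "1 + \<epsilon>" "real b" "real k"] assms by simp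
  then show "real (nat \<lfloor>(1 + \<epsilon>) * real k\<rfloor> - b) \<le> (1 + \<epsilon>) * k - b"
    and "(1 + \<epsilon>) * k - b \<le> real (nat \<lfloor>(1 + \<epsilon>) * real k\<rfloor> - b) + 1"
    by linarith+
qed

lemma floor_diff_ratio_bounds:
  fixes \<epsilon> :: real
  assumes "0 \<le> \<epsilon>" "b \<le> k" "k > 0"
  shows "real (nat \<lfloor>(1 + \<epsilon>) * real k\<rfloor> - b) / k \<le> 1 + \<epsilon> - b / k"
    and "1 + \<epsilon> - b / k \<le> real (nat \<lfloor>(1 + \<epsilon>) * real k\<rfloor> - b) / k + 1 / k"
proof -
  have "1 + \<epsilon> - b / k = ((1 + \<epsilon>) * k - b) / k"
    using assms by (simp add: diff_divide_distrib)
  then show "real (nat \<lfloor>(1 + \<epsilon>) * real k\<rfloor> - b) / k \<le> 1 + \<epsilon> - b / k"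
    and "1 + \<epsilon> - b / k \<le> real (nat \<lfloor>(1 + \<epsilon>) * real k\<rfloor> - b) / k + 1 / k"
    using floor_diff_bounds[OF assms(1,2)] assms(3)
    unfolding add_divide_distrib[symmetric] by (simp_all only: divide_right_mono of_nat_0_le_iff)
qed

text \<open>The error term depends on \<open>k\<close> but not on \<open>b\<close>, which makes the
  union bound uniform. The margin \<open>\<delta>\<close> keeps \<open>u \<ge> \<delta> * k\<close>,
  so the floor in \<open>k'\<close> moves \<open>m / u\<close> by at most
  \<open>1 / (\<delta> * k)\<close>.\<close>

lemma row_mgf_le_limit_mgf:
  fixes \<nu> \<epsilon> \<delta> l :: real and k b :: nat
  assumes \<nu>: "\<nu> > 0" and \<epsilon>: "0 \<le> \<epsilon>" "\<epsilon> < 1" and \<delta>: "\<delta> > 0" and l: "l \<ge> 0"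
    and k: "k > 0" "\<nu> / k \<le> 1 / 2" and b: "b \<le> (1 - \<delta>) * k"
  defines "k' \<equiv> nat \<lfloor>(1 + \<epsilon>) * real k\<rfloor>"
  defines "A \<equiv> exp (- \<nu> * (1 + \<epsilon>))"
  shows "row_mgf (\<nu> / k) l k' (k' - b) (k - b) \<le> limit_mgf l (b / k) \<nu> \<epsilon> +
    (\<bar>(1 - \<nu> / k) ^ k' - A\<bar> + \<nu> * l / (\<delta> * k) +
     2 * \<nu> * (exp l - 1) * (\<bar>(1 - \<nu> / k) ^ (k' - 1) - A\<bar> + 2 * \<nu>\<^sup>2 / k))"
proof -
  define q \<zeta> z u m where "q = \<nu> / k" and "\<zeta> = b / k" and "z = 1 + \<epsilon> - \<zeta>"
    and "u = k - b" and "m = k' - b"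
  have q: "0 < q" "q \<le> 1 / 2" using \<nu> k by (auto simp: q_def)
  have \<zeta>: "0 \<le> \<zeta>" "\<zeta> \<le> 1 - \<delta>"
    using b k by (auto simp: \<zeta>_def pos_divide_le_eq)
  have z: "0 < z" "z \<le> 2" using \<zeta> \<epsilon> \<delta> by (auto simp: z_def)
  have "real b < k"
  proof -
    have "(1 - \<delta>) * k < 1 * real k" using \<delta> k by (intro mult_strict_right_mono) auto
    then show ?thesis using b by simp
  qed
  then have u: "u > 0" "real u = k * (1 - \<zeta>)"
    using k by (auto simp: u_def \<zeta>_def right_diff_distrib)
  have kz: "k * z = (1 + \<epsilon>) * k - b"
    using k by (simp add: z_def \<zeta>_def field_simps)
  have m_le: "real m \<le> k * z" "k * z \<le> real m + 1"
    using floor_diff_bounds[OF \<epsilon>(1), of b k] \<open>real b < k\<close> unfolding kz m_def k'_def by auto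
  have qu: "q * u = \<nu> * (1 - \<zeta>)" "q * k = \<nu>"
    using k by (auto simp: q_def u)
  have ratio: "m / u \<le> z / (1 - \<zeta>)" "z / (1 - \<zeta>) - m / u \<le> 1 / (\<delta> * k)"
  proof -
    have eq: "z / (1 - \<zeta>) = k * z / u"
      using k by (simp add: u)
    show "m / u \<le> z / (1 - \<zeta>)"
      unfolding eq using m_le by (intro divide_right_mono) auto
    have "k * z / u - m / u \<le> 1 / u"
      unfolding diff_divide_distrib[symmetric] using m_le by (intro divide_right_mono) auto
    also have "\<dots> \<le> 1 / (\<delta> * k)"
      using \<delta> k u \<zeta> by (intro divide_left_mono) (auto simp: mult.commute intro!: mult_left_mono)
    finally show "z / (1 - \<zeta>) - m / u \<le> 1 / (\<delta> * k)"
      unfolding eq .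
  qed
  define V where "V = exp (- (l * (m / u)))"
  define V0 where "V0 = exp (- (l * z / (1 - \<zeta>)))"
  have V: "0 \<le> V" "V \<le> 1" "V \<le> V0 + l / (\<delta> * k)"
  proof -
    have "V \<le> V0 + \<bar>l * (m / u) - l * z / (1 - \<zeta>)\<bar>"
      unfolding V_def V0_def using l by (intro exp_minus_le) auto
    also have "\<bar>l * (m / u) - l * z / (1 - \<zeta>)\<bar> = l * (z / (1 - \<zeta>) - m / u)"
      using mult_left_mono[OF ratio(1) l] by (simp add: right_diff_distrib)
    also have "\<dots> \<le> l * (1 / (\<delta> * k))"
      using ratio(2) l by (intro mult_left_mono)
    finally show "V \<le> V0 + l / (\<delta> * k)" by simp
  qed (use l in \<open>auto simp: V_def\<close>)
  define W where "W = exp (\<nu> * (1 - \<zeta>) * (V0 - 1))"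
  have W01: "0 \<le> W" "W \<le> 1"
    using \<nu> \<zeta> \<delta> l z by (auto simp: W_def V0_def intro!: mult_nonneg_nonpos)
  have pow_le: "0 \<le> (1 - q) ^ j" "(1 - q) ^ j \<le> 1" for j :: nat
    using q by (auto intro!: power_le_one)
  \<comment> \<open>The inequality \<open>1 + x \<le> exp x\<close> turns the power into an
    exponential; replacing \<open>V\<close> by \<open>V0\<close> then costs at most
    \<open>q * u \<le> \<nu>\<close> times their distance.\<close>
  have W: "(1 - q + q * V) ^ u \<le> W + \<nu> * l / (\<delta> * k)"
  proof -
    have "(1 - q + q * V) ^ u \<le> exp (- (q * (1 - V))) ^ u"
    proof (rule power_mono)
      show "1 - q + q * V \<le> exp (- (q * (1 - V)))"
        using exp_ge_add_one_self[of "- (q * (1 - V))"] by (simp add: algebra_simps)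
      show "0 \<le> 1 - q + q * V"
        using q V by (intro add_nonneg_nonneg) auto
    qed
    also have "\<dots> = exp (- (\<nu> * (1 - \<zeta>) * (1 - V)))"
      unfolding qu(1)[symmetric] by (simp add: exp_of_nat_mult[symmetric] algebra_simps)
    also have "\<dots> \<le> exp (- (\<nu> * (1 - \<zeta>) * (1 - V0))) + \<nu> * l / (\<delta> * k)"
    proof -
      have c: "0 \<le> \<nu> * (1 - \<zeta>)" "\<nu> * (1 - \<zeta>) \<le> \<nu>"
        using \<nu> \<zeta> \<delta> by (auto simp: mult_left_le)
      have V0_le: "V0 \<le> V"
        unfolding V0_def V_def using mult_left_mono[OF ratio(1) l] by simp
      have "exp (- (\<nu> * (1 - \<zeta>) * (1 - V))) \<le> exp (- (\<nu> * (1 - \<zeta>) * (1 - V0))) +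
          \<bar>\<nu> * (1 - \<zeta>) * (1 - V) - \<nu> * (1 - \<zeta>) * (1 - V0)\<bar>"
        using V by (intro exp_minus_le mult_nonneg_nonneg[OF c(1)]) auto
      also have "\<nu> * (1 - \<zeta>) * (1 - V) - \<nu> * (1 - \<zeta>) * (1 - V0) = - (\<nu> * (1 - \<zeta>) * (V - V0))"
        by (simp add: algebra_simps)
      also have "\<bar>- (\<nu> * (1 - \<zeta>) * (V - V0))\<bar> = \<nu> * (1 - \<zeta>) * (V - V0)"
        using c V0_le by simp
      also have "\<dots> \<le> \<nu> * (l / (\<delta> * k))"
        using c V V0_le \<nu> by (intro mult_mono) auto
      finally show ?thesis by simp
    qed
    also have "exp (- (\<nu> * (1 - \<zeta>) * (1 - V0))) = W"
      by (simp add: W_def algebra_simps)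
    finally show ?thesis .
  qed
  have t1: "(1 - q) ^ k' * ((1 - q + q * V) ^ u - 1) \<le>
      A * (W - 1) + \<bar>(1 - q) ^ k' - A\<bar> + \<nu> * l / (\<delta> * k)"
  proof -
    have "(1 - q) ^ k' * ((1 - q + q * V) ^ u - 1) \<le> (1 - q) ^ k' * (W - 1 + \<nu> * l / (\<delta> * k))"
      using W pow_le by (intro mult_left_mono) auto
    \<comment> \<open>Regrouped so that the error of the power is multiplied by
      \<open>1 - W\<close>, which lies between 0 and 1.\<close>
    also have "\<dots> = A * (W - 1) + (A - (1 - q) ^ k') * (1 - W) + (1 - q) ^ k' * (\<nu> * l / (\<delta> * k))"
      by (simp add: algebra_simps)
    also have "(A - (1 - q) ^ k') * (1 - W) \<le> \<bar>(1 - q) ^ k' - A\<bar> * 1"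
      using W01 by (intro mult_mono) auto
    also have "(1 - q) ^ k' * (\<nu> * l / (\<delta> * k)) \<le> 1 * (\<nu> * l / (\<delta> * k))"
      using pow_le \<nu> l \<delta> by (intro mult_right_mono) auto
    finally show ?thesis by simp
  qed
  have t2: "m * q * (1 - q) ^ (k' - 1) * (1 - (1 - q) ^ u) * (exp l - 1) \<le>
      z * \<nu> * A * (1 - exp (- \<nu> * (1 - \<zeta>))) * (exp l - 1) +
      2 * \<nu> * (exp l - 1) * (\<bar>(1 - q) ^ (k' - 1) - A\<bar> + 2 * \<nu>\<^sup>2 / k)"
  proof -
    define X where "X = 1 - exp (- \<nu> * (1 - \<zeta>))"
    have X: "0 \<le> X" "X \<le> 1" using \<nu> \<zeta> \<delta> by (auto simp: X_def)
    \<comment> \<open>Rounding \<open>k'\<close> down only helps here, so no error term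
      arises.\<close>
    have mq: "m * q \<le> z * \<nu>"
      using mult_right_mono[OF m_le(1), of q] q k by (simp add: q_def field_simps)
    have "1 - (1 - q) ^ u \<le> X + 2 * \<nu>\<^sup>2 / k"
    proof -
      have "exp (- (u * q)) - 2 * real u * q\<^sup>2 \<le> (1 - q) ^ u"
        using q by (intro one_minus_power_ge) auto
      moreover have "exp (- (u * q)) = exp (- \<nu> * (1 - \<zeta>))"
        using qu by (simp add: mult.commute)
      moreover have "2 * real u * q\<^sup>2 \<le> 2 * real k * q\<^sup>2"
        by (intro mult_right_mono) (auto simp: u_def)
      moreover have "2 * real k * q\<^sup>2 = 2 * \<nu>\<^sup>2 / k"
        using k by (simp add: q_def power2_eq_square)
      ultimately show ?thesis by (simp add: X_def)
    qed
    then have "(1 - q) ^ (k' - 1) * (1 - (1 - q) ^ u) \<le> (1 - q) ^ (k' - 1) * (X + 2 * \<nu>\<^sup>2 / k)"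
      using pow_le by (intro mult_left_mono) auto
    also have "\<dots> = A * X + ((1 - q) ^ (k' - 1) - A) * X + (1 - q) ^ (k' - 1) * (2 * \<nu>\<^sup>2 / k)"
      by (simp add: algebra_simps)
    also have "((1 - q) ^ (k' - 1) - A) * X \<le> \<bar>(1 - q) ^ (k' - 1) - A\<bar> * 1"
      using X by (intro mult_mono) auto
    also have "(1 - q) ^ (k' - 1) * (2 * \<nu>\<^sup>2 / k) \<le> 1 * (2 * \<nu>\<^sup>2 / k)"
      using pow_le by (intro mult_right_mono) auto
    finally have "(1 - q) ^ (k' - 1) * (1 - (1 - q) ^ u) \<le>
        A * X + (\<bar>(1 - q) ^ (k' - 1) - A\<bar> + 2 * \<nu>\<^sup>2 / k)" by simp
    then have "(m * q) * ((1 - q) ^ (k' - 1) * (1 - (1 - q) ^ u)) \<le>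
        (z * \<nu>) * (A * X + (\<bar>(1 - q) ^ (k' - 1) - A\<bar> + 2 * \<nu>\<^sup>2 / k))"
      using z \<nu> pow_le by (intro mult_mono[OF mq]) (auto intro!: mult_nonneg_nonneg)
    also have "\<dots> = z * \<nu> * A * X + z * \<nu> * (\<bar>(1 - q) ^ (k' - 1) - A\<bar> + 2 * \<nu>\<^sup>2 / k)"
      by (simp add: algebra_simps)
    \<comment> \<open>The bound \<open>z \<le> 2\<close> is applied to the error part alone; the
      main term keeps its exact factor \<open>z\<close>.\<close>
    also have "z * \<nu> * (\<bar>(1 - q) ^ (k' - 1) - A\<bar> + 2 * \<nu>\<^sup>2 / k) \<le>
        2 * \<nu> * (\<bar>(1 - q) ^ (k' - 1) - A\<bar> + 2 * \<nu>\<^sup>2 / k)"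
      using z \<nu> by (intro mult_right_mono) auto
    finally have "(m * q) * ((1 - q) ^ (k' - 1) * (1 - (1 - q) ^ u)) * (exp l - 1) \<le>
        (z * \<nu> * A * X + 2 * \<nu> * (\<bar>(1 - q) ^ (k' - 1) - A\<bar> + 2 * \<nu>\<^sup>2 / k)) * (exp l - 1)"
      using l by (intro mult_right_mono) auto
    also have "\<dots> = z * \<nu> * A * X * (exp l - 1) +
        2 * \<nu> * (exp l - 1) * (\<bar>(1 - q) ^ (k' - 1) - A\<bar> + 2 * \<nu>\<^sup>2 / k)"
    proof -
      have "(a + 2 * \<nu> * E) * e = a * e + 2 * \<nu> * e * E" for a E e :: real
        by (simp add: algebra_simps)
      then show ?thesis .
    qed
    finally show ?thesis
      unfolding X_def mult.assoc .
  qed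
  have "row_mgf q l k' m u = 1 + (1 - q) ^ k' * ((1 - q + q * V) ^ u - 1) +
      m * q * (1 - q) ^ (k' - 1) * (1 - (1 - q) ^ u) * (exp l - 1)"
    by (simp add: row_mgf_def V_def)
  moreover have "limit_mgf l \<zeta> \<nu> \<epsilon> = A * (W - 1) + z * \<nu> * A * (1 - exp (- \<nu> * (1 - \<zeta>))) * (exp l - 1) + 1"
    by (simp add: limit_mgf_def A_def W_def V0_def z_def)
  ultimately have "row_mgf q l k' m u \<le> limit_mgf l \<zeta> \<nu> \<epsilon> +
    (\<bar>(1 - q) ^ k' - A\<bar> + \<nu> * l / (\<delta> * k) +
     2 * \<nu> * (exp l - 1) * (\<bar>(1 - q) ^ (k' - 1) - A\<bar> + 2 * \<nu>\<^sup>2 / k))"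
    using t1 t2 by linarith
  then show ?thesis
    by (simp add: q_def \<zeta>_def m_def u_def)
qed

section \<open>Asymptotics\<close>

text \<open>Merges the count of the sets, the price of lying in \<open>PD\<close> and the power of
  the moment generating function into one exponential on the scale \<open>k * ln (p / k)\<close>;
  \<open>N\<close> is the number of tests measured on that scale.\<close>

lemma union_term_le:
  fixes \<nu> \<epsilon> \<delta> l \<eta> \<beta> e :: real and k p n b :: nat
  assumes \<nu>: "\<nu> > 0" and \<epsilon>: "0 \<le> \<epsilon>" "\<epsilon> < 1" and \<delta>: "\<delta> > 0" and l: "l \<ge> 0"
    and k: "k > 0" "\<nu> / k \<le> 1 / 2" "2 \<le> \<delta> * k" and b: "real b < (1 - \<delta>) * k" and e: "e \<ge> 0"
    and L: "ln (p / k) > 0"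
  defines "k' \<equiv> nat \<lfloor>(1 + \<epsilon>) * real k\<rfloor>"
    and "z \<equiv> 1 + \<epsilon> - b / k"
    and "N \<equiv> n / (k * ln (p / k))"
  assumes mgf: "row_mgf (\<nu> / k) l k' (k' - b) (k - b) \<le> exp (- z * \<beta>) + e"
  shows "2 ^ k * (p choose (k' - b)) *
      ((1 - \<nu> / k) ^ ((k' - b) * nat \<lceil>(1 - \<eta>) * n * (1 - \<nu> / k) ^ k\<rceil>) *
       row_mgf (\<nu> / k) l k' (k' - b) (k - b) ^ n) \<le>
    exp (k * ln (p / k) *
      ((k' - b) / k * (1 + \<bar>1 - ln (\<delta> / 2)\<bar> / ln (p / k) - \<nu> * (1 - \<eta>) * (1 - \<nu> / k) ^ k * N)
       - z * (N * \<beta>) + (ln 2 / ln (p / k) + N * (e * exp (2 * \<bar>\<beta>\<bar>)))))"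
proof -
  define m c \<rho> L C where "m = k' - b" and "c = nat \<lceil>(1 - \<eta>) * n * (1 - \<nu> / k) ^ k\<rceil>"
    and "\<rho> = (1 - \<nu> / k) ^ k" and "L = ln (p / k)" and "C = \<bar>1 - ln (\<delta> / 2)\<bar>"
  let ?M = "row_mgf (\<nu> / k) l k' (k' - b) (k - b)"
  have "real b < k"
  proof -
    have "(1 - \<delta>) * k \<le> 1 * real k" using \<delta> by (intro mult_right_mono) auto
    then show ?thesis using b by simp
  qed
  have kz: "k * z = (1 + \<epsilon>) * k - b"
    using k by (simp add: z_def field_simps)
  have m_le: "real m \<le> k * z" "k * z \<le> real m + 1"
    using floor_diff_bounds[OF \<epsilon>(1), of b k] \<open>real b < k\<close> unfolding kz m_def k'_def by auto
  have z: "0 \<le> z" "z \<le> 2"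
  proof -
    have "0 \<le> b / k" "b / k \<le> 1" using \<open>real b < k\<close> k by auto
    then show "0 \<le> z" "z \<le> 2" using \<epsilon> unfolding z_def by linarith+
  qed
  \<comment> \<open>Rounding costs at most 1, and \<open>2 \<le> \<delta> * k\<close> makes this at
    most half of \<open>\<delta> * k\<close>.\<close>
  have m_ge: "\<delta> / 2 * k \<le> m" "m > 0"
  proof -
    have "\<delta> * k + \<epsilon> * k \<le> k * z"
      using b unfolding kz by (simp add: algebra_simps)
    moreover have "0 \<le> \<epsilon> * k" using \<epsilon> by simp
    ultimately have "\<delta> * k - 1 \<le> m" using m_le by linarith
    then have "\<delta> / 2 * k \<le> m \<and> 0 < real m" using k by auto
    then show "\<delta> / 2 * k \<le> m" "m > 0" by auto
  qed
  have p: "real p > 0" "real p / k > 0"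
    using L k by (auto intro!: divide_pos_pos gr0I)
  \<comment> \<open>As \<open>m\<close> is at least a constant multiple of \<open>k\<close>,
    replacing \<open>p / m\<close> by \<open>p / k\<close> costs only the constant \<open>C\<close>
    per item.\<close>
  have choose: "real (p choose m) \<le> exp (m * (L + C))"
  proof -
    have "real (p choose m) \<le> (exp 1 * p / m) ^ m"
      using m_ge by (intro binomial_le_exp_pow)
    also have "\<dots> \<le> (exp 1 * p / (\<delta> / 2 * k)) ^ m"
      using m_ge \<delta> k by (intro power_mono divide_left_mono mult_pos_pos) auto
    also have "exp 1 * p / (\<delta> / 2 * k) = exp (1 + L - ln (\<delta> / 2))"
      using \<delta> k p by (simp add: exp_add exp_diff L_def)
    also have "\<dots> ^ m \<le> exp (L + C) ^ m"
      unfolding C_def by (intro power_mono) auto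
    finally show ?thesis by (simp add: exp_of_nat_mult)
  qed
  have neg: "(1 - \<nu> / k) ^ (m * c) \<le> exp (- (\<nu> / k * m * ((1 - \<eta>) * n * \<rho>)))"
  proof -
    have "(1 - \<nu> / k) ^ (m * c) \<le> exp (- (\<nu> / k)) ^ (m * c)"
      using k exp_ge_add_one_self[of "- (\<nu> / k)"] by (intro power_mono) auto
    also have "\<dots> = exp (- (\<nu> / k * m * c))"
      by (simp add: exp_of_nat_mult[symmetric] algebra_simps)
    also have "\<dots> \<le> exp (- (\<nu> / k * m * ((1 - \<eta>) * n * \<rho>)))"
      using \<nu> unfolding exp_le_cancel_iff neg_le_iff_le
      by (intro mult_left_mono) (auto simp: c_def \<rho>_def intro: real_nat_ceiling_ge)
    finally show ?thesis .
  qed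
  have M0: "?M \<ge> 0"
    using \<nu> k l by (intro row_mgf_nonneg) auto
  \<comment> \<open>The additive error moves into the exponent by factoring out
    \<open>exp (- z * \<beta>)\<close>; \<open>z \<le> 2\<close> then makes its coefficient
    independent of \<open>b\<close>.\<close>
  have Mn: "?M ^ n \<le> exp (n * (- z * \<beta> + e * exp (2 * \<bar>\<beta>\<bar>)))"
  proof -
    have "exp (z * \<beta>) \<le> exp (2 * \<bar>\<beta>\<bar>)"
    proof -
      have "z * \<beta> \<le> z * \<bar>\<beta>\<bar>" using z by (intro mult_left_mono) auto
      also have "\<dots> \<le> 2 * \<bar>\<beta>\<bar>" using z by (intro mult_right_mono) auto
      finally show ?thesis by simp
    qed
    then have "1 + e * exp (z * \<beta>) \<le> 1 + e * exp (2 * \<bar>\<beta>\<bar>)"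
      using e by (simp add: mult_left_mono)
    also have "\<dots> \<le> exp (e * exp (2 * \<bar>\<beta>\<bar>))"
      by (rule exp_ge_add_one_self)
    finally have "exp (- z * \<beta>) * (1 + e * exp (z * \<beta>)) \<le> exp (- z * \<beta>) * exp (e * exp (2 * \<bar>\<beta>\<bar>))"
      by (intro mult_left_mono) auto
    moreover have "exp (- z * \<beta>) * (1 + e * exp (z * \<beta>)) = exp (- z * \<beta>) + e"
      by (simp add: distrib_left exp_minus)
    ultimately have "?M \<le> exp (- z * \<beta> + e * exp (2 * \<bar>\<beta>\<bar>))"
      unfolding exp_add using mgf by linarith
    then have "?M ^ n \<le> exp (- z * \<beta> + e * exp (2 * \<bar>\<beta>\<bar>)) ^ n"
      using M0 by (intro power_mono)
    then show ?thesis
      by (simp only: exp_of_nat_mult)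
  qed
  have n: "real n = N * (k * L)" and L0: "L \<noteq> 0"
    using L k by (auto simp: N_def L_def)
  have "2 ^ k * real (p choose m) * ((1 - \<nu> / k) ^ (m * c) * ?M ^ n) \<le>
      exp (k * ln 2) * exp (m * (L + C)) *
      (exp (- (\<nu> / k * m * ((1 - \<eta>) * n * \<rho>))) * exp (n * (- z * \<beta> + e * exp (2 * \<bar>\<beta>\<bar>))))"
    using choose neg Mn M0 k by (intro mult_mono) (auto simp: exp_of_nat_mult)
  also have "\<dots> = exp (k * ln 2 + m * (L + C) - \<nu> / k * m * ((1 - \<eta>) * n * \<rho>) +
      n * (- z * \<beta> + e * exp (2 * \<bar>\<beta>\<bar>)))"
    by (simp add: exp_add[symmetric])
  also have "k * ln 2 + m * (L + C) - \<nu> / k * m * ((1 - \<eta>) * n * \<rho>) +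
      n * (- z * \<beta> + e * exp (2 * \<bar>\<beta>\<bar>)) =
    k * L * (m / k * (1 + C / L - \<nu> * (1 - \<eta>) * \<rho> * N) - z * (N * \<beta>) +
      (ln 2 / L + N * (e * exp (2 * \<bar>\<beta>\<bar>))))"
    unfolding n using k L0 by (simp add: field_simps)
  finally show "2 ^ k * (p choose (k' - b)) *
      ((1 - \<nu> / k) ^ ((k' - b) * nat \<lceil>(1 - \<eta>) * n * (1 - \<nu> / k) ^ k\<rceil>) * ?M ^ n) \<le>
    exp (k * ln (p / k) *
      ((k' - b) / k * (1 + \<bar>1 - ln (\<delta> / 2)\<bar> / ln (p / k) - \<nu> * (1 - \<eta>) * (1 - \<nu> / k) ^ k * N)
       - z * (N * \<beta>) + (ln 2 / ln (p / k) + N * (e * exp (2 * \<bar>\<beta>\<bar>)))))"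
    unfolding m_def c_def L_def C_def \<rho>_def by simp
qed

section \<open>Asymptotics of the number of tests\<close>

lemma filterlim_ln_ratio_at_top:
  fixes k :: "nat \<Rightarrow> nat"
  assumes k_range: "\<And>p. p \<ge> 1 \<Longrightarrow> 1 \<le> k p \<and> k p \<le> p"
    and k_sublinear: "(\<lambda>p. real (k p)) \<in> o(\<lambda>p. real p)"
  shows "filterlim (\<lambda>p. ln (real p / real (k p))) at_top at_top"
proof -
  have "((\<lambda>p. real (k p) / real p) \<longlongrightarrow> 0) at_top"
    using k_sublinear by (rule smalloD_tendsto)
  moreover have "\<forall>\<^sub>F p in at_top. 0 < real (k p) / real p"
    using eventually_ge_at_top[of 1]
  proof eventually_elim
    case (elim p)
    then show ?case using k_range[of p] by auto
  qed
  ultimately have "filterlim (\<lambda>p. inverse (real (k p) / real p)) at_top at_top"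
    by (rule filterlim_inverse_at_top)
  then show ?thesis
    using filterlim_compose[OF ln_at_top] by (fastforce simp: inverse_eq_divide)
qed

text \<open>Follows from \<open>(p / k) ^ k \<le> (p choose k)\<close> and
  \<open>(p choose k) \<le> (exp 1 * p / k) ^ k\<close>; the floor costs at most one test.\<close>

lemma num_tests_bounds:
  assumes k: "1 \<le> k" "k \<le> p" and R: "R > 0"
  shows "k * ln (p / k) / (R * ln 2) - 1 \<le> num_tests p k R"
    and "num_tests p k R \<le> k * (1 + ln (p / k)) / (R * ln 2)"
proof -
  define x where "x = ln (real (p choose k))"
  have pk: "real p / k > 0" "p choose k > 0" using k by auto
  have x: "k * ln (p / k) \<le> x" "x \<le> k * (1 + ln (p / k))"
  proof -
    have "k * ln (p / k) = ln ((p / k) ^ k)"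
      using pk by (simp add: ln_realpow)
    also have "\<dots> \<le> x"
      unfolding x_def using binomial_ge_n_over_k_pow_k[OF k(2), where 'a = real] pk by (intro ln_mono) auto
    finally show "k * ln (p / k) \<le> x" .
    have "x \<le> ln ((exp 1 * p / k) ^ k)"
      unfolding x_def using binomial_le_exp_pow[of k p] k pk by (intro ln_mono) auto
    also have "\<dots> = k * ln (exp 1 * (p / k))"
      using pk by (simp add: ln_realpow)
    also have "\<dots> = k * (1 + ln (p / k))"
      using pk by (subst ln_mult) auto
    finally show "x \<le> k * (1 + ln (p / k))" .
  qed
  have x0: "x \<ge> 0"
    using pk unfolding x_def by (intro ln_ge_zero) linarith
  have nt: "num_tests p k R = nat \<lfloor>x / (R * ln 2)\<rfloor>"
    by (simp add: num_tests_def log_def x_def field_simps)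
  have "x / (R * ln 2) \<ge> 0" using x0 R by simp
  then have *: "num_tests p k R \<le> x / (R * ln 2)" "x / (R * ln 2) - 1 \<le> num_tests p k R"
    unfolding nt by (auto simp: of_nat_nat)
  have "k * ln (p / k) / (R * ln 2) \<le> x / (R * ln 2)" "x / (R * ln 2) \<le> k * (1 + ln (p / k)) / (R * ln 2)"
    using x R by (auto intro!: divide_right_mono)
  with * show "k * ln (p / k) / (R * ln 2) - 1 \<le> num_tests p k R"
    and "num_tests p k R \<le> k * (1 + ln (p / k)) / (R * ln 2)"
    by linarith+
qed

text \<open>The floor contributes an error of order \<open>1 / (k * L)\<close> and the factor
  \<open>exp 1 ^ k\<close> one of order \<open>1 / L\<close>, where
  \<open>L = ln (p / k)\<close>.\<close>

lemma num_tests_ratio_tendsto: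
  fixes k :: "nat \<Rightarrow> nat"
  assumes k_range: "\<And>p. p \<ge> 1 \<Longrightarrow> 1 \<le> k p \<and> k p \<le> p"
    and k_infinity: "filterlim k at_top at_top"
    and L: "filterlim (\<lambda>p. ln (real p / real (k p))) at_top at_top" and R: "R > 0"
  shows "(\<lambda>p. num_tests p (k p) R / (k p * ln (p / k p))) \<longlonglongrightarrow> 1 / (R * ln 2)"
proof (rule tendsto_sandwich)
  let ?L = "\<lambda>p. ln (real p / real (k p))"
  have kr: "filterlim (\<lambda>p. real (k p)) at_top at_top"
    using filterlim_compose[OF filterlim_real_sequentially k_infinity] .
  have invk: "(\<lambda>p. 1 / real (k p)) \<longlonglongrightarrow> 0" and invL: "(\<lambda>p. 1 / ?L p) \<longlonglongrightarrow> 0"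
    using tendsto_divide_0[OF tendsto_const filterlim_at_top_imp_at_infinity] kr L by blast+
  have "(\<lambda>p. 1 / (R * ln 2) - 1 / real (k p) * (1 / ?L p)) \<longlonglongrightarrow> 1 / (R * ln 2) - 0 * 0"
    by (intro tendsto_intros invk invL)
  then show "(\<lambda>p. 1 / (R * ln 2) - 1 / real (k p) * (1 / ?L p)) \<longlonglongrightarrow> 1 / (R * ln 2)" by simp
  have "(\<lambda>p. 1 / (R * ln 2) * (1 + 1 / ?L p)) \<longlonglongrightarrow> 1 / (R * ln 2) * (1 + 0)"
    by (intro tendsto_intros invL)
  then show "(\<lambda>p. 1 / (R * ln 2) * (1 + 1 / ?L p)) \<longlonglongrightarrow> 1 / (R * ln 2)" by simp
  have ev: "\<forall>\<^sub>F p in at_top. ?L p > 0 \<and> p \<ge> 1"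
    using L by (intro eventually_conj eventually_ge_at_top) (simp add: filterlim_at_top_dense)
  show "\<forall>\<^sub>F p in at_top. 1 / (R * ln 2) - 1 / real (k p) * (1 / ?L p) \<le>
      num_tests p (k p) R / (k p * ln (p / k p))"
    using ev
  proof eventually_elim
    case (elim p)
    then have kL: "k p * ?L p > 0" using k_range[of p] by auto
    have "1 / (R * ln 2) - 1 / real (k p) * (1 / ?L p) = (k p * ?L p / (R * ln 2) - 1) / (k p * ?L p)"
      using kL by (auto simp: diff_divide_distrib zero_less_mult_iff)
    also have "\<dots> \<le> num_tests p (k p) R / (k p * ?L p)"
      using kL R elim k_range[of p] by (intro divide_right_mono num_tests_bounds) auto
    finally show ?case .
  qed
  show "\<forall>\<^sub>F p in at_top. num_tests p (k p) R / (k p * ln (p / k p)) \<le>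
      1 / (R * ln 2) * (1 + 1 / ?L p)"
    using ev
  proof eventually_elim
    case (elim p)
    then have kL: "k p * ?L p > 0" using k_range[of p] by auto
    have "num_tests p (k p) R / (k p * ?L p) \<le> (k p * (1 + ?L p) / (R * ln 2)) / (k p * ?L p)"
      using kL R elim k_range[of p] by (intro divide_right_mono num_tests_bounds) auto
    also have "\<dots> = 1 / (R * ln 2) * (1 + 1 / ?L p)"
      using kL elim[THEN conjunct1] R by (simp add: zero_less_mult_iff field_simps)
    finally show ?case .
  qed
qed

text \<open>The shift \<open>i\<close> covers both exponents in \<open>row_mgf\<close>:
  \<open>k'\<close> for \<open>i = 0\<close> and \<open>k' - 1\<close> for
  \<open>i = 1\<close>.\<close>

lemma floor_ratio_tendsto:
  fixes k :: "'a \<Rightarrow> nat"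
  assumes k: "filterlim k at_top F" and a: "a \<ge> 0"
  shows "((\<lambda>p. real (nat \<lfloor>a * real (k p)\<rfloor> - i) / real (k p)) \<longlongrightarrow> a) F"
proof (rule tendsto_sandwich)
  have kr: "filterlim (\<lambda>p. real (k p)) at_top F"
    using filterlim_compose[OF filterlim_real_sequentially k] .
  have "((\<lambda>p. a - (1 + i) / real (k p)) \<longlongrightarrow> a - 0) F"
    by (intro tendsto_intros tendsto_divide_0[OF tendsto_const filterlim_at_top_imp_at_infinity] kr)
  then show "((\<lambda>p. a - (1 + i) / real (k p)) \<longlongrightarrow> a) F" by simp
  show "((\<lambda>p. a) \<longlongrightarrow> a) F" by simp
  have ev: "\<forall>\<^sub>F p in F. real (k p) > 0"
    using kr unfolding filterlim_at_top_dense by blast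
  show "\<forall>\<^sub>F p in F. a - (1 + i) / real (k p) \<le> real (nat \<lfloor>a * real (k p)\<rfloor> - i) / real (k p)"
    using ev
  proof eventually_elim
    case (elim p)
    have "a * k p - 1 - i \<le> real (nat \<lfloor>a * real (k p)\<rfloor> - i)"
      using a by linarith
    then have "(a * k p - 1 - i) / k p \<le> real (nat \<lfloor>a * real (k p)\<rfloor> - i) / real (k p)"
      using elim by (intro divide_right_mono) auto
    moreover have "(a * k p - 1 - i) / k p = a - (1 + i) / real (k p)"
      using elim by (simp add: diff_divide_distrib add_divide_distrib)
    ultimately show ?case by simp
  qed
  show "\<forall>\<^sub>F p in F. real (nat \<lfloor>a * real (k p)\<rfloor> - i) / real (k p) \<le> a"
    using ev
  proof eventually_elim
    case (elim p)
    have "a * real (k p) \<ge> 0" using a by simp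
    then have "real (nat \<lfloor>a * real (k p)\<rfloor> - i) \<le> a * k p"
      by linarith
    then show ?case using elim by (simp add: field_simps)
  qed
qed

theorem theoremB13:
  fixes k :: "nat \<Rightarrow> nat" and \<nu> R \<delta> \<epsilon> :: real
  assumes k_range: "\<And>p. p \<ge> 1 \<Longrightarrow> 1 \<le> k p \<and> k p \<le> p"
    and k_infinity: "filterlim k at_top at_top"
    and k_sublinear: "(\<lambda>p. real (k p)) \<in> o(\<lambda>p. real p)"
    and "\<nu> > 0"
    and "R \<in> {0<..<1}"
    and "\<delta> \<in> {0..<1}"
    and "\<epsilon> \<in> {0..<1}"
    and "\<delta> * \<epsilon> > 0"
    and rate: "R < rate_threshold \<nu> \<delta> \<epsilon>"
  shows "(\<lambda>p. measure_pmf.prob (group_testing_pmf p (k p) (num_tests p (k p) R) \<nu>)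
            {(D, X). \<not> (\<exists>\<sigma>. bad_local_minimum p (k p) (num_tests p (k p) R) \<delta> \<epsilon> D X \<sigma>)})
         \<longlonglongrightarrow> 1"
proof -

  \<comment> \<open>Parameters, error terms and the exponent gap\<close>
  have \<delta>: "0 < \<delta>" "\<delta> < 1" and \<epsilon>: "0 \<le> \<epsilon>" "\<epsilon> < 1" and \<nu>: "0 < \<nu>" and R: "0 < R"
    using assms(4-8) by (auto simp: zero_less_mult_iff)
  obtain l \<gamma> where l: "l \<ge> 0" and \<gamma>: "\<gamma> > 0" and lim:
    "\<And>\<zeta>. \<zeta> \<in> {0..<1 - \<delta>} \<Longrightarrow>
      limit_mgf l \<zeta> \<nu> \<epsilon> \<le> exp (- (1 + \<epsilon> - \<zeta>) * ((R + \<gamma>) * ln 2 - \<nu> * exp (- \<nu>)))"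
    using rate_threshold_witness[OF \<nu> \<epsilon>(1) \<delta> rate] by blast
  define \<beta> where "\<beta> = (R + \<gamma>) * ln 2 - \<nu> * exp (- \<nu>)"
  \<comment> \<open>Chosen so that
    \<open>\<nu> * \<eta> * exp (- \<nu>) * \<tau> = \<gamma> / (2 * R)\<close>: the allowance for
    missing negative tests spends half of the slack.\<close>
  define \<eta> where "\<eta> = \<gamma> * ln 2 * exp \<nu> / (2 * \<nu>)"
  define A where "A = exp (- \<nu> * (1 + \<epsilon>))"
  define \<tau> where "\<tau> = 1 / (R * ln 2)"
  define k' where "k' p = nat \<lfloor>(1 + \<epsilon>) * real (k p)\<rfloor>" for p
  define n where "n p = num_tests p (k p) R" for p
  define L where "L p = ln (real p / real (k p))" for p
  define N where "N p = n p / (k p * L p)" for p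
  define \<rho> where "\<rho> p = (1 - \<nu> / k p) ^ k p" for p
  define e where "e p = \<bar>(1 - \<nu> / k p) ^ k' p - A\<bar> + \<nu> * l / (\<delta> * k p) +
     2 * \<nu> * (exp l - 1) * (\<bar>(1 - \<nu> / k p) ^ (k' p - 1) - A\<bar> + 2 * \<nu>\<^sup>2 / k p)" for p
  define U where "U p = 1 + \<bar>1 - ln (\<delta> / 2)\<bar> / L p - \<nu> * (1 - \<eta>) * \<rho> p * N p" for p
  define U0 where "U0 = 1 - \<nu> * (1 - \<eta>) * exp (- \<nu>) * \<tau>"
  define W where "W p = ln 2 / L p + N p * (e p * exp (2 * \<bar>\<beta>\<bar>))" for p
  \<comment> \<open>Collects the rounding of \<open>k'\<close>, the deviations of \<open>U\<close>
    and \<open>N * \<beta>\<close> from their limits, with 2 as a bound for \<open>z\<close>, and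
    the lower-order terms \<open>W\<close>.\<close>
  define err where "err p = \<bar>U p\<bar> / k p + 2 * \<bar>U p - U0\<bar> + 2 * \<bar>N p * \<beta> - \<tau> * \<beta>\<bar> + W p" for p
  \<comment> \<open>With \<open>z \<ge> \<delta>\<close> the limiting exponent is at most
    \<open>- 2 * \<kappa>\<close>; one half of it is reserved for absorbing
    \<open>err\<close>.\<close>
  define \<kappa> where "\<kappa> = \<delta> * \<gamma> / (4 * R)"
  have \<eta>: "\<eta> > 0" and \<kappa>: "\<kappa> > 0" and \<tau>: "\<tau> > 0"
    using \<gamma> \<nu> R \<delta> by (auto simp: \<eta>_def \<kappa>_def \<tau>_def)
  \<comment> \<open>The limiting exponent per unit of \<open>z\<close>; with
    \<open>\<eta> = 0\<close> it would be \<open>- \<gamma> / R\<close>.\<close>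
  have gap: "U0 - \<tau> * \<beta> = - (\<gamma> / (2 * R))"
  proof -
    have "\<nu> * \<eta> * exp (- \<nu>) * \<tau> = \<gamma> / (2 * R)"
      using \<nu> R by (simp add: \<eta>_def \<tau>_def exp_minus)
    moreover have "\<tau> * \<beta> = 1 + \<gamma> / R - \<nu> * exp (- \<nu>) * \<tau>"
      using R by (simp add: \<tau>_def \<beta>_def field_simps)
    ultimately show ?thesis
      by (simp add: U0_def algebra_simps)
  qed

  \<comment> \<open>Limits of the parameters and the error terms\<close>
  have kr: "filterlim (\<lambda>p. real (k p)) at_top at_top"
    using filterlim_compose[OF filterlim_real_sequentially k_infinity] .
  have Ltop: "filterlim L at_top at_top"
    unfolding L_def by (rule filterlim_ln_ratio_at_top[OF k_range k_sublinear])
  have Nlim: "N \<longlonglongrightarrow> \<tau>"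
    using num_tests_ratio_tendsto[OF k_range k_infinity Ltop[unfolded L_def] R]
    by (simp add: N_def[abs_def] n_def L_def \<tau>_def)
  have \<rho>lim: "\<rho> \<longlonglongrightarrow> exp (- \<nu>)"
  proof -
    have "\<forall>\<^sub>F p in at_top. real (k p) / real (k p) = 1"
      using eventually_ge_at_top[of 1]
    proof eventually_elim
      case (elim p)
      then show ?case using k_range[of p] by simp
    qed
    then have "(\<lambda>p. real (k p) / real (k p)) \<longlonglongrightarrow> 1"
      by (rule tendsto_eventually)
    from one_minus_power_tendsto_exp[OF k_infinity this \<nu>] show ?thesis
      by (simp add: \<rho>_def[abs_def])
  qed
  have inv_k: "(\<lambda>p. c / real (k p)) \<longlonglongrightarrow> 0" and inv_L: "(\<lambda>p. c / L p) \<longlonglongrightarrow> 0" for c :: real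
    by (rule tendsto_divide_0[OF tendsto_const filterlim_at_top_imp_at_infinity], fact)+
  have elim0: "e \<longlonglongrightarrow> 0"
  proof -
    have "(\<lambda>p. real (k' p - i) / real (k p)) \<longlonglongrightarrow> 1 + \<epsilon>" for i
      unfolding k'_def using \<epsilon> by (intro floor_ratio_tendsto k_infinity) auto
    then have pow: "(\<lambda>p. (1 - \<nu> / k p) ^ (k' p - i)) \<longlonglongrightarrow> A" for i
      unfolding A_def by (rule one_minus_power_tendsto_exp[OF k_infinity _ \<nu>])
    have "(\<lambda>p. \<bar>(1 - \<nu> / k p) ^ (k' p - 0) - A\<bar> + \<nu> * l / \<delta> / k p +
     2 * \<nu> * (exp l - 1) * (\<bar>(1 - \<nu> / k p) ^ (k' p - 1) - A\<bar> + 2 * \<nu>\<^sup>2 / k p)) \<longlonglongrightarrow>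
      \<bar>A - A\<bar> + 0 + 2 * \<nu> * (exp l - 1) * (\<bar>A - A\<bar> + 0)"
      by (intro tendsto_intros pow inv_k)
    then show ?thesis
      by (simp add: e_def[abs_def])
  qed
  have Ulim: "U \<longlonglongrightarrow> U0"
  proof -
    have "U \<longlonglongrightarrow> 1 + 0 - \<nu> * (1 - \<eta>) * exp (- \<nu>) * \<tau>"
      unfolding U_def[abs_def] by (intro tendsto_intros inv_L \<rho>lim Nlim)
    then show ?thesis by (simp add: U0_def)
  qed
  have errlim: "err \<longlonglongrightarrow> 0"
  proof -
    have "(\<lambda>p. \<bar>U p\<bar> * (1 / k p) + 2 * \<bar>U p - U0\<bar> + 2 * \<bar>N p * \<beta> - \<tau> * \<beta>\<bar> + W p) \<longlonglongrightarrow>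
      \<bar>U0\<bar> * 0 + 2 * \<bar>U0 - U0\<bar> + 2 * \<bar>\<tau> * \<beta> - \<tau> * \<beta>\<bar> + (0 + \<tau> * (0 * exp (2 * \<bar>\<beta>\<bar>)))"
      unfolding W_def[abs_def] by (intro tendsto_intros inv_L inv_k Ulim Nlim elim0)
    then show ?thesis
      by (simp add: err_def[abs_def])
  qed

  \<comment> \<open>Bound on the failure probability for large \<open>p\<close>\<close>
  let ?bad = "\<lambda>p D X. \<exists>\<sigma>. bad_local_minimum p (k p) (n p) \<delta> \<epsilon> D X \<sigma>"
  let ?P = "\<lambda>p. measure_pmf.prob (group_testing_pmf p (k p) (n p) \<nu>)"
  let ?bound = "\<lambda>p. exp (- (\<eta>\<^sup>2 / 2 * \<rho> p * n p)) + k p * exp (- (\<kappa> * k p))"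
  \<comment> \<open>\<open>k \<ge> 2 * \<nu>\<close> makes \<open>\<nu> / k\<close> a genuine
    probability of at most one half, and \<open>k \<ge> 2 / \<delta>\<close> leaves room for the
    rounding of \<open>k'\<close>.\<close>
  have "\<forall>\<^sub>F p in at_top. p \<ge> 1 \<and> real (k p) \<ge> 2 * \<nu> \<and> real (k p) \<ge> 2 / \<delta> \<and> L p \<ge> 1 \<and> err p < \<kappa>"
    using kr Ltop order_tendstoD(2)[OF errlim \<kappa>]
    by (intro eventually_conj eventually_ge_at_top)
       (auto simp: filterlim_at_top)
  then have bad_le: "\<forall>\<^sub>F p in at_top. ?P p {(D, X). ?bad p D X} \<le> ?bound p"
  proof eventually_elim
    case (elim p)
    then have k: "1 \<le> k p" "k p \<le> p" "\<nu> / k p \<le> 1 / 2" "2 \<le> \<delta> * k p" and q: "\<nu> / k p \<in> {0<..<1}"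
      and L1: "L p \<ge> 1" and err: "err p < \<kappa>"
      using k_range[of p] \<nu> \<delta> by (auto simp: field_simps)
    have e0: "e p \<ge> 0"
      using \<nu> l \<delta> by (auto simp: e_def intro!: add_nonneg_nonneg mult_nonneg_nonneg)
    have uniform: "2 ^ k p * (p choose (k' p - b)) *
        ((1 - \<nu> / k p) ^ ((k' p - b) * nat \<lceil>(1 - \<eta>) * n p * (1 - \<nu> / k p) ^ k p\<rceil>) *
         row_mgf (\<nu> / k p) l (k' p) (k' p - b) (k p - b) ^ n p) \<le> exp (- (\<kappa> * k p))"
      if "int b < \<lfloor>(1 - \<delta>) * real (k p)\<rfloor>" for b
    proof -
      have b: "real b < (1 - \<delta>) * k p"
        using that unfolding less_floor_iff by auto
      define z where "z = 1 + \<epsilon> - b / k p"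
      define \<mu> where "\<mu> = (k' p - b) / k p"
      have \<zeta>: "b / k p \<in> {0..<1 - \<delta>}"
        using b k by (simp add: pos_divide_less_eq)
      then have z: "\<delta> \<le> z" "z \<le> 2"
        using \<epsilon> unfolding z_def atLeastLessThan_iff by linarith+
      have mgf: "row_mgf (\<nu> / k p) l (k' p) (k' p - b) (k p - b) \<le> exp (- z * \<beta>) + e p"
        using row_mgf_le_limit_mgf[OF \<nu> \<epsilon> \<delta>(1) l _ k(3) less_imp_le[OF b]] lim[OF \<zeta>] k
        by (simp add: k'_def e_def A_def z_def \<beta>_def)
      have "real b < k p"
      proof -
        have "b / k p < 1" using \<zeta> \<delta> unfolding atLeastLessThan_iff by linarith
        then show ?thesis using k by (simp add: pos_divide_less_eq)
      qed
      then have \<mu>: "\<mu> \<le> z" "z \<le> \<mu> + 1 / k p"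
        unfolding \<mu>_def z_def k'_def using \<epsilon> k by (auto intro!: floor_diff_ratio_bounds)
      \<comment> \<open>The counting part carries the rounded ratio \<open>\<mu>\<close> and the
        other part carries \<open>z\<close>. They differ by at most \<open>1 / k\<close>, so
        \<open>\<mu>\<close> is exchanged for \<open>z\<close> before passing to the limits.\<close>
      have "\<mu> * U p - z * (N p * \<beta>) + W p \<le> z * (U0 - \<tau> * \<beta>) + err p"
      proof -
        have "(\<mu> - z) * U p \<le> (1 / k p) * \<bar>U p\<bar>"
        proof -
          have "(\<mu> - z) * U p \<le> \<bar>\<mu> - z\<bar> * \<bar>U p\<bar>" by (simp add: abs_mult[symmetric])
          also have "\<dots> \<le> (1 / k p) * \<bar>U p\<bar>" using \<mu> by (intro mult_right_mono) auto
          finally show ?thesis .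
        qed
        moreover have "z * x \<le> 2 * \<bar>x\<bar>" for x
        proof -
          have "z * x \<le> z * \<bar>x\<bar>" using z \<delta> by (intro mult_left_mono) auto
          also have "\<dots> \<le> 2 * \<bar>x\<bar>" using z by (intro mult_right_mono) auto
          finally show ?thesis .
        qed
        from this[of "U p - U0"] this[of "\<tau> * \<beta> - N p * \<beta>"]
        have "z * (U p - U0) \<le> 2 * \<bar>U p - U0\<bar>" "z * (\<tau> * \<beta> - N p * \<beta>) \<le> 2 * \<bar>N p * \<beta> - \<tau> * \<beta>\<bar>"
          by (simp_all add: abs_minus_commute)
        moreover have "\<mu> * U p - z * (N p * \<beta>) =
            z * (U0 - \<tau> * \<beta>) + (\<mu> - z) * U p + z * (U p - U0) + z * (\<tau> * \<beta> - N p * \<beta>)"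
          by (simp add: algebra_simps)
        ultimately show ?thesis
          by (simp add: err_def)
      qed
      also have "\<dots> \<le> - \<kappa>"
      proof -
        have "\<delta> * (\<gamma> / (2 * R)) \<le> z * (\<gamma> / (2 * R))"
          using z \<gamma> R by (intro mult_right_mono) auto
        moreover have "\<delta> * (\<gamma> / (2 * R)) = 2 * \<kappa>"
          by (simp add: \<kappa>_def)
        ultimately show ?thesis
          using err unfolding gap by simp
      qed
      finally have "k p * L p * (\<mu> * U p - z * (N p * \<beta>) + W p) \<le> k p * L p * - \<kappa>"
        using L1 by (intro mult_left_mono) auto
      \<comment> \<open>The exponent is negative, so \<open>L \<ge> 1\<close> allows the factor
        \<open>L\<close> to be dropped.\<close>
      also have "\<dots> \<le> - (\<kappa> * k p)"
        using mult_left_mono[of 1 "L p" "\<kappa> * k p"] \<kappa> L1 by (simp add: mult_ac)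
      finally have "exp (k p * L p * (\<mu> * U p - z * (N p * \<beta>) + W p)) \<le> exp (- (\<kappa> * k p))"
        by simp
      moreover have L0: "ln (p / k p) > 0"
        using L1 unfolding L_def by linarith
      have k0: "k p > 0" using k by simp
      note union_term_le[OF \<nu> \<epsilon> \<delta>(1) l k0 k(3,4) b e0 L0 mgf[unfolded z_def k'_def], of \<eta>]
      ultimately show ?thesis
        unfolding U_def W_def N_def L_def \<rho>_def \<mu>_def z_def k'_def by (rule order_trans[rotated])
    qed
    have "?P p {(D, X). ?bad p D X} \<le> ?bound p"
      unfolding group_testing_pmf_def
    proof (rule prob_pair_pmf_le)
      fix D assume "D \<in> set_pmf (pmf_of_set {D. D \<subseteq> {..<p} \<and> card D = k p})"
      \<comment> \<open>The support of \<open>pmf_of_set\<close> is the given set only if that set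
        is finite and nonempty.\<close>
      moreover have "{..<k p} \<in> {D. D \<subseteq> {..<p} \<and> card D = k p}"
        using k by auto
      then have "{D. D \<subseteq> {..<p} \<and> card D = k p} \<noteq> {}" by blast
      moreover have "finite {D. D \<subseteq> {..<p} \<and> card D = k p}"
        by (rule finite_subset[of _ "Pow {..<p}"]) auto
      ultimately have D: "D \<subseteq> {..<p}" "card D = k p"
        by (auto simp: set_pmf_of_set)
      show "measure_pmf.prob (Pi_pmf ({..<n p} \<times> {..<p}) False (\<lambda>_. bernoulli_pmf (\<nu> / k p)))
          {X. ?bad p D X} \<le> ?bound p"
        unfolding \<rho>_def
        using prob_exists_bad_local_minimum_le[OF D q l \<eta> less_imp_le[OF \<delta>(1)], of "exp (- (\<kappa> * k p))" \<epsilon> "n p"]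
          uniform by (simp add: k'_def)
    qed
    then show ?case .
  qed

  \<comment> \<open>Vanishing of the bound\<close>
  have bound_lim: "?bound \<longlonglongrightarrow> 0"
  proof -
    have "filterlim (\<lambda>p. \<eta>\<^sup>2 / 2 * \<rho> p * n p) at_top at_top"
    proof -
      \<comment> \<open>As \<open>N\<close> has a positive limit, \<open>n\<close> grows like
        \<open>k * L\<close>, so the Chernoff exponent diverges.\<close>
      have lim: "filterlim (\<lambda>p. \<eta>\<^sup>2 / 2 * \<rho> p * N p * (k p * L p)) at_top at_top"
      proof (rule filterlim_tendsto_pos_mult_at_top)
        show "(\<lambda>p. \<eta>\<^sup>2 / 2 * \<rho> p * N p) \<longlonglongrightarrow> \<eta>\<^sup>2 / 2 * exp (- \<nu>) * \<tau>"
          by (intro tendsto_intros \<rho>lim Nlim)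
        show "0 < \<eta>\<^sup>2 / 2 * exp (- \<nu>) * \<tau>" using \<eta> \<tau> by simp
        show "filterlim (\<lambda>p. k p * L p) at_top at_top"
          by (rule filterlim_at_top_mult_at_top[OF kr Ltop])
      qed
      have ev: "\<forall>\<^sub>F p in at_top. \<eta>\<^sup>2 / 2 * \<rho> p * N p * (k p * L p) = \<eta>\<^sup>2 / 2 * \<rho> p * n p"
        using filterlim_at_top_dense[THEN iffD1, OF kr, rule_format, of 0]
          filterlim_at_top_dense[THEN iffD1, OF Ltop, rule_format, of 0]
        by eventually_elim (simp add: N_def)
      show ?thesis
        using filterlim_cong[OF refl refl ev] lim by (rule iffD1)
    qed
    then have "(\<lambda>p. exp (- (\<eta>\<^sup>2 / 2 * \<rho> p * n p))) \<longlonglongrightarrow> 0"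
      by (intro filterlim_compose[OF exp_at_bot] filterlim_uminus_at_top[THEN iffD1])
    \<comment> \<open>The factor \<open>k\<close>, which counts the overlaps, is beaten by the
      exponential decay in \<open>k\<close>.\<close>
    moreover have "((\<lambda>x::real. x * exp (- (\<kappa> * x))) \<longlongrightarrow> 0) at_top"
      using \<kappa> by real_asymp
    from filterlim_compose[OF this kr] have "(\<lambda>p. k p * exp (- (\<kappa> * k p))) \<longlonglongrightarrow> 0" .
    ultimately show ?thesis
      using tendsto_add by fastforce
  qed
  have "(\<lambda>p. ?P p {(D, X). ?bad p D X}) \<longlonglongrightarrow> 0"
    by (rule tendsto_sandwich[OF _ bad_le tendsto_const bound_lim]) simp
  then have "(\<lambda>p. 1 - ?P p {(D, X). ?bad p D X}) \<longlonglongrightarrow> 1 - 0"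
    by (intro tendsto_intros)
  moreover have "1 - ?P p {(D, X). ?bad p D X} = ?P p {(D, X). \<not> ?bad p D X}" for p
  proof -
    have "{(D, X). \<not> ?bad p D X} = UNIV - {(D, X). ?bad p D X}" by auto
    then show ?thesis
      using measure_pmf.prob_compl[of "{(D, X). ?bad p D X}" "group_testing_pmf p (k p) (n p) \<nu>"] by simp
  qed
  ultimately show ?thesis
    by (simp add: n_def)
qed

end
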